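(* For any integers $r\ge 1$, $n\ge 1$ and $w\ge (r+2)n+1$, we have $$S_w\begin{pmatrix}\{1\}^{n-1}, & 1\\ \{r\}^{n-1}, & r+1\end{pmatrix}=c_{w,r}(n)\,\zeta(w),\qquad c_{w,r}(n):=\frac{w-1}{n}\binom{w-(r+1)n-2}{n-1}.$$
   Context: An index is a tuple of positive integers; its depth is its length, its weight $\mathrm{wt}$ is the sum of its entries; a non-empty index is admissible if its last entry is $\ge 2$ (the empty index is admissible). $\{x\}^{m}$ means $x$ repeated $m$ times. $\zeta(w)=\sum_{m\ge 1}m^{-w}$. For integers $w,s_1,\ldots,s_n\ge 0$ and $r_1,\ldots,r_n>0$ define $$S_w\begin{pmatrix}s_1,\ldots,s_n\\ r_1,\ldots,r_n\end{pmatrix}:=\sum \zeta\begin{pmatrix}\boldsymbol{l}_1,\ldots,\boldsymbol{l}_n\\ \boldsymbol{k}_1,\ldots,\boldsymbol{k}_n\end{pmatrix},$$ the sum being over all indices $\boldsymbol{l}_i$ of depth $s_i$ and all admissible indices $\boldsymbol{k}_i$ of depth $r_i$ ($1\le i\le n$) with $\sum_i\mathrm{wt}(\boldsymbol{k}_i)+\sum_i\mathrm{wt}(\boldsymbol{l}_i)=w$. Here, for $\boldsymbol{l}_i=(l_{i,1},\ldots,l_{i,s_i})$ and $\boldsymbol{k}_i=(k_{i,1},\ldots,k_{i,r_i})$, $$\zeta\begin{pmatrix}\boldsymbol{l}_1,\ldots,\boldsymbol{l}_n\\ \boldsymbol{k}_1,\ldots,\boldsymbol{k}_n\end{pmatrix}:=\sum\prod_{i=1}^n\frac{1}{a_{i,1}^{k_{i,1}}\cdots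 a_{i,r_i}^{k_{i,r_i}}\,b_{i,1}^{l_{i,1}}\cdots b_{i,s_i}^{l_{i,s_i}}},$$ summed over all positive integers with $0<b_{i,1}\le\cdots\le b_{i,s_i+1}$, $0<a_{i,1}<\cdots<a_{i,r_i}$, $b_{i,s_i+1}=a_{i,r_i}$ for $i=1,\ldots,n$, and $b_{i+1,1}<a_{i,1}$ for $i=1,\ldots,n-1$ (so the $b_{i,s_i+1}$ are not extra free variables; the definition makes sense also when some $s_i=0$). *)

theory Defs
  imports "HOL-Analysis.Analysis"
begin

type_synonym index = "nat list"

definition is_index :: "index \<Rightarrow> bool" where
  "is_index k \<longleftrightarrow> (\<forall>x\<in>set k. 0 < x)"

definition admissible :: "index \<Rightarrow> bool" where
  "admissible k \<longleftrightarrow> is_index k \<and> (k \<noteq> [] \<longrightarrow> 2 \<le> last k)"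

abbreviation depth :: "index \<Rightarrow> nat" where
  "depth \<equiv> length"

abbreviation wt :: "index \<Rightarrow> nat" where
  "wt \<equiv> sum_list"

definition zeta :: "nat \<Rightarrow> real" where
  "zeta w = (\<Sum>m. 1 / real (Suc m) ^ w)"

text \<open>
  Only the free variables of a row of \<open>b\<close>'s are summed over; \<open>ext_row b a\<close> appends the
  dependent final entry, which equals the last entry of the corresponding row \<open>a\<close>. The head
  of the extended row is thus defined (and equal to \<open>last a\<close>) also when \<open>b\<close> is empty.
\<close>

definition ext_row :: "nat list \<Rightarrow> nat list \<Rightarrow> nat list" where
  "ext_row b a = b @ [last a]"

definition summation_range :: "nat list \<Rightarrow> nat list \<Rightarrow> (nat list list \<times> nat list list) set" where
  "summation_range ss rs =
    {(as, bs). map length as = rs \<and> map length bs = ss \<and>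
       (\<forall>a\<in>set as. \<forall>x\<in>set a. 0 < x) \<and> (\<forall>b\<in>set bs. \<forall>x\<in>set b. 0 < x) \<and>
       (\<forall>i<length rs. sorted_wrt (<) (as ! i) \<and> sorted_wrt (\<le>) (ext_row (bs ! i) (as ! i))) \<and>
       (\<forall>i. Suc i < length rs \<longrightarrow> hd (ext_row (bs ! Suc i) (as ! Suc i)) < hd (as ! i))}"

text \<open>
  All terms are nonnegative, so unordered summation is the appropriate notion.
\<close>

definition multizeta :: "index list \<Rightarrow> index list \<Rightarrow> real" where
  "multizeta ls ks =
    (\<Sum>\<^sub>\<infinity>(as, bs)\<in>summation_range (map depth ls) (map depth ks).
       \<Prod>i<length ks.
         1 / ((\<Prod>j<depth (ks ! i). real (as ! i ! j) ^ (ks ! i ! j)) *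
              (\<Prod>j<depth (ls ! i). real (bs ! i ! j) ^ (ls ! i ! j))))"

text \<open>
  The index set of the outer sum is finite, since all entries are positive and the total
  weight and all depths are fixed. \<open>ss\<close> and \<open>rs\<close> are the two rows of the symbol and are
  meant to have the same length \<open>n\<close>, with all entries of \<open>rs\<close> positive.
\<close>

definition S :: "nat \<Rightarrow> nat list \<Rightarrow> nat list \<Rightarrow> real" where
  "S w ss rs =
    (\<Sum>(ls, ks)\<in>{(ls, ks). map depth ls = ss \<and> map depth ks = rs \<and>
        (\<forall>l\<in>set ls. is_index l) \<and> (\<forall>k\<in>set ks. admissible k) \<and>
        sum_list (map wt ks) + sum_list (map wt ls) = w}.
      multizeta ls ks)"

definition c :: "nat \<Rightarrow> nat \<Rightarrow> nat \<Rightarrow> real" where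
  "c w r n = real (w - 1) / real n * real ((w - (r + 1) * n - 2) choose (n - 1))"

end

theory Submission
  imports Defs
begin

text \<open>
  Moving each $b_{i+1,1}$ in front of $\boldsymbol{a}_i$ turns the $n$ rows into $n$ strictly
  increasing chains $C_1, \ldots, C_n$ of the same length $r+1$, linked by
  $\min C_i \le \max C_{i+1}$, together with a free $b \le \max C_1$. With the weight as
  exponent of a variable $t \in (0,1)$ every entry $x$ contributes $t/(x-t)$, and every maximum an
  additional factor $t/x$.

  Write $e_q$ for the sum over $q$ chains with $\max C_{i+1} < \min C_i$ and $y_q$ for the same sum
  with a free $b \le \max C_1$. As a strict link and the complementary weak link add up to no
  link, the ribbon sums are determined by $e_q$ and $y_q$ through a Newton-type recursion.
  Ohno's relation for $(\{r+2\}^q)$, proved by transport along the connector of Seki and Yamamoto,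
  identifies $e_q$ with the elementary symmetric function of
  $\lambda_m = (t/m)^{r+1}\, t/(m-t)$. Differentiating the connector in an auxiliary parameter
  inserts $b$ and gives $y_q = \sum_m \delta_m \lambda_m e_{q-1}(\lambda_j : j \ne m)$ with
  $\delta_m = (r+1)t/m + t/(m-t)$. Hence the ribbon sum is $\sum_m \delta_m \lambda_m^n$, and its
  power series expansion in $t$ has the coefficients $c_{w,r}(n)\,\zeta(w)$.
\<close>

section \<open>Sums in $[0,\infty]$\<close>

text \<open>Every sum runs over a whole type, and range conditions become \<open>of_bool\<close>
  factors. In [0,\<infinity>] linearity and the exchange of sums then hold without summability
  conditions.\<close>

definition nsum :: "('a \<Rightarrow> ennreal) \<Rightarrow> ennreal" (binder "\<Sum>\<^sup>+" 10) where
  "nsum f = (\<integral>\<^sup>+x. f x \<partial>count_space UNIV)"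

lemma nsum_cong: "(\<And>x. f x = g x) \<Longrightarrow> nsum f = nsum g"
  by (rule arg_cong[where f = nsum]) auto

lemma nsum_add: "(\<Sum>\<^sup>+x. f x + g x) = nsum f + nsum g"
  unfolding nsum_def by (rule nn_integral_add) auto

lemma nsum_cmult: "(\<Sum>\<^sup>+x. d * f x) = d * nsum f"
  unfolding nsum_def by (rule nn_integral_cmult) auto

lemma nsum_multc: "(\<Sum>\<^sup>+x. f x * d) = nsum f * d"
  unfolding nsum_def by (rule nn_integral_multc) auto

lemma nsum_0 [simp]: "(\<Sum>\<^sup>+x. 0) = 0"
  unfolding nsum_def by simp

lemma nsum_prod: "nsum f = (\<Sum>\<^sup>+x. \<Sum>\<^sup>+y. f (x, y))"
  unfolding nsum_def by (rule nn_integral_fst_count_space [symmetric])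

lemma nsum_swap: "(\<Sum>\<^sup>+x. \<Sum>\<^sup>+y. f x y) = (\<Sum>\<^sup>+y. \<Sum>\<^sup>+x. f x y)"
  unfolding nsum_def
  using nn_integral_fst_count_space[of "\<lambda>(x, y). f x y"] nn_integral_snd_count_space[of "\<lambda>(x, y). f x y"]
  by simp

lemma nsum_mono: "(\<And>x. f x \<le> g x) \<Longrightarrow> nsum f \<le> nsum g"
  unfolding nsum_def by (rule nn_integral_mono) auto

lemma nsum_delta [simp]: "(\<Sum>\<^sup>+x. of_bool (x = a) * f x) = f a"
proof -
  have "(\<Sum>\<^sup>+x. of_bool (x = a) * f x) = (\<integral>\<^sup>+x. f x * indicator {a} x \<partial>count_space UNIV)"
    unfolding nsum_def by (intro nn_integral_cong) (auto split: split_indicator)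
  also have "\<dots> = (\<integral>\<^sup>+x. f x \<partial>count_space {a})"
    by (simp add: nn_integral_count_space_indicator)
  also have "\<dots> = f a"
    by (simp add: nn_integral_count_space_finite)
  finally show ?thesis .
qed

lemma nsum_ge: "f a \<le> nsum f"
proof -
  have "f a = (\<Sum>\<^sup>+x. of_bool (x = a) * f x)" by simp
  also have "\<dots> \<le> nsum f" by (rule nsum_mono) auto
  finally show ?thesis .
qed

lemma nsum_list: "nsum f = f [] + (\<Sum>\<^sup>+x. \<Sum>\<^sup>+xs. f (x # xs))"
proof -
  have b: "bij_betw (\<lambda>(x, xs). x # xs) UNIV (- {[]})"
    by (rule bij_betwI[where g = "\<lambda>ys. (hd ys, tl ys)"]) auto
  have "(\<Sum>\<^sup>+x. \<Sum>\<^sup>+xs. f (x # xs)) = (\<integral>\<^sup>+p. f (case p of (x, xs) \<Rightarrow> x # xs) \<partial>count_space UNIV)"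
    using nsum_prod[of "\<lambda>(x, xs). f (x # xs)"] by (simp add: nsum_def case_prod_unfold)
  also have "\<dots> = (\<integral>\<^sup>+ys. f ys \<partial>count_space (- {[]}))"
    by (rule nn_integral_bij_count_space[OF b])
  also have "\<dots> = (\<Sum>\<^sup>+ys. of_bool (ys \<noteq> []) * f ys)"
    unfolding nsum_def
    by (subst nn_integral_count_space_indicator, simp)
       (intro nn_integral_cong, auto split: split_indicator)
  finally have *: "(\<Sum>\<^sup>+x. \<Sum>\<^sup>+xs. f (x # xs)) = (\<Sum>\<^sup>+ys. of_bool (ys \<noteq> []) * f ys)" .
  have "nsum f = (\<Sum>\<^sup>+ys. of_bool (ys = []) * f ys + of_bool (ys \<noteq> []) * f ys)"
    by (rule arg_cong[where f = nsum]) (auto simp: fun_eq_iff)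
  also have "\<dots> = f [] + (\<Sum>\<^sup>+x. \<Sum>\<^sup>+xs. f (x # xs))"
    by (simp add: nsum_add *)
  finally show ?thesis .
qed

lemma nsum_nat: "nsum f = (\<Sum>n. f n)" for f :: "nat \<Rightarrow> ennreal"
  unfolding nsum_def by (rule nn_integral_count_space_nat)

lemma nsum_nat_greater: "(\<Sum>\<^sup>+a. of_bool (m < a) * f a) = (\<Sum>k. f (Suc (m + k)))"
proof -
  have "(\<Sum>\<^sup>+a. of_bool (m < a) * f a) =
        (\<Sum>k. of_bool (m < k + Suc m) * f (k + Suc m)) + (\<Sum>k<Suc m. of_bool (m < k) * f k)"
    unfolding nsum_nat by (rule suminf_offset) auto
  also have "(\<Sum>k<Suc m. of_bool (m < k) * f k) = 0"
    by (intro sum.neutral) auto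
  finally show ?thesis by (simp add: add_ac)
qed

text \<open>\<open>u\<close> is a potential vanishing at infinity, so only its value at the lower
  end survives; nonnegative terms let the real series pass to [0,\<infinity>].\<close>

lemma nsum_telescope:
  fixes u f :: "nat \<Rightarrow> real"
  assumes f: "\<And>k. m \<le> k \<Longrightarrow> f (Suc k) = u k - u (Suc k)"
    and nn: "\<And>k. m \<le> k \<Longrightarrow> 0 \<le> f (Suc k)"
    and lim: "u \<longlonglongrightarrow> 0"
  shows "(\<Sum>\<^sup>+a. of_bool (m < a) * ennreal (f a)) = ennreal (u m)"
proof -
  have "(\<lambda>k. u (m + k)) \<longlonglongrightarrow> 0"
    using LIMSEQ_ignore_initial_segment[OF lim, of m] by (simp add: add_ac)
  from telescope_sums'[OF this] have "(\<lambda>k. f (Suc (m + k))) sums u m"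
    by (simp add: f)
  then show ?thesis
    unfolding nsum_nat_greater by (intro suminf_ennreal_eq) (simp_all add: nn)
qed

section \<open>The connector\<close>

text \<open>The algebra of the telescoping in \<open>nsum_g_Conn_deriv\<close>: \<open>p\<close> is
  the next entry minus \<open>t\<close>, \<open>k\<close> the connector at that entry and
  \<open>l\<close> the logarithmic derivative one entry earlier.\<close>

lemma telescope_identity1:
  fixes t p m k l :: real
  assumes "0 < p" "0 < m"
  shows "t / p * (k * (l + t / (p + m))) =
      t / m * (k * (p + m) / p * l) + (t / m)\<^sup>2 * (k * (p + m) / p) -
      (t / m * (k * (l + t / (p + m))) + (t / m)\<^sup>2 * k)"
proof -
  have "p + m \<noteq> 0" using assms by simp
  \<comment> \<open>In these quotients the claim is a polynomial consequence of the two relations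
    proved next.\<close>
  define M P Q R where MPQR: "M = t / m" "P = t / p" "Q = t / (p + m)" "R = (p + m) / p"
  have "P = M * (R - 1)" "M * P - M * Q = P * Q"
    using assms \<open>p + m \<noteq> 0\<close> unfolding MPQR
    by ((simp add: divide_simps); simp add: algebra_simps)+
  then have "P * (k * (l + Q)) = M * (k * R * l) + M\<^sup>2 * (k * R) - (M * (k * (l + Q)) + M\<^sup>2 * k)"
    by algebra
  then show ?thesis by (simp add: MPQR)
qed

text \<open>The dual case, for \<open>nsum_g_Conn_deriv'\<close>: here \<open>k\<close> and
  \<open>l\<close> both belong to the next entry.\<close>

lemma telescope_identity2:
  fixes t p a k l :: real
  assumes "0 < p" "0 < a"
  shows "t / p * (k * l + t / p * k) =
    t / a * (k * (p + a) / p * (l + t / p - t / (p + a))) - t / a * (k * l)"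
proof -
  have "p + a \<noteq> 0" using assms by simp
  define A P Q R where APQR: "A = t / a" "P = t / p" "Q = t / (p + a)" "R = (p + a) / p"
  have "P = A * (R - 1)" "R * Q = P"
    using assms \<open>p + a \<noteq> 0\<close> unfolding APQR
    by ((simp add: divide_simps); simp add: algebra_simps)+
  then have "P * (k * l + P * k) = A * (k * R * (l + P - Q)) - A * (k * l)"
    by algebra
  then show ?thesis by (simp add: APQR)
qed

section \<open>The connector, its logarithmic derivative and their decay\<close>

locale generating_variable =
  fixes t :: real
  assumes t_pos: "0 < t" and t_less: "t < 1"
begin

text \<open>
  The Seki--Yamamoto connector
  $\Gamma(a+1-t)\,\Gamma(m+1-t) / (\Gamma(1-t)\,\Gamma(a+m+1-t))$. Replacing $t$ by $t+x$ in the
  factors with $m$ and with $a+m$ gives a second connector whose logarithmic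
  derivative at $x=0$, times $t$, is \<open>conn_log\<close>.
\<close>

definition conn :: "nat \<Rightarrow> nat \<Rightarrow> real" where
  "conn a m = pochhammer (1 - t) a * pochhammer (1 - t) m / pochhammer (1 - t) (a + m)"

definition conn_log :: "nat \<Rightarrow> nat \<Rightarrow> real" where
  "conn_log a m = (\<Sum>b<a. t / (real (Suc (m + b)) - t))"

lemma less_Suc: "t < real (Suc k)"
  using t_less by (simp add: add.commute add_strict_increasing)

lemma less_Suc': "t < 1 + real k"
  using less_Suc[of k] by simp

lemma less_Suc_add: "t < 1 + (real k + real l)"
  using less_Suc[of "k + l"] by simp

lemma pochhammer_pos': "0 < pochhammer (1 - t) n"
  using t_less by (intro pochhammer_pos) simp

lemma conn_nonneg: "0 \<le> conn a m"
  unfolding conn_def using pochhammer_pos'[of a] pochhammer_pos'[of m] pochhammer_pos'[of "a + m"]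
  by simp

lemma conn_0 [simp]: "conn 0 m = 1" "conn a 0 = 1"
  using pochhammer_pos'[of a] pochhammer_pos'[of m] by (simp_all add: conn_def)

lemma conn_sym: "conn a m = conn m a"
  by (simp add: conn_def add.commute mult.commute)

lemma conn_Suc: "conn (Suc a) m * (real (Suc (a + m)) - t) = conn a m * (real (Suc a) - t)"
proof -
  have "real (Suc (a + m)) - t \<noteq> 0" using less_Suc[of "a + m"] by simp
  then show ?thesis
    using pochhammer_pos'[of "a + m"]
    by (simp add: conn_def pochhammer_Suc divide_simps) (simp add: algebra_simps)
qed

text \<open>This difference equation lets a sum over \<open>a\<close> telescope: a denominator in
  \<open>a\<close> is traded for one in \<open>m\<close>.\<close>

lemma conn_step: "conn a m - conn (Suc a) m = real m / (real (Suc a) - t) * conn (Suc a) m"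
proof -
  have "real (Suc a) - t \<noteq> 0" using less_Suc[of a] by simp
  with conn_Suc[of a m] show ?thesis by (simp add: field_simps)
qed

lemma conn_antimono: "a \<le> a' \<Longrightarrow> conn a' m \<le> conn a m"
proof (induction rule: dec_induct)
  case (step k)
  have "0 \<le> real m / (real (Suc k) - t) * conn (Suc k) m"
    using less_Suc[of k] conn_nonneg by simp
  with step conn_step[of k m] show ?case by linarith
qed auto

lemma conn_1: "conn (Suc 0) a = (1 - t) / (real (Suc a) - t)"
proof -
  have "real (Suc a) - t \<noteq> 0" using less_Suc[of a] by simp
  then show ?thesis using conn_Suc[of 0 a] by (simp add: field_simps)
qed

text \<open>By symmetry the connector also decreases in \<open>m\<close>, so \<open>m = 1\<close> is
  the worst case, and there it has a closed form.\<close>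

lemma conn_le: "1 \<le> m \<Longrightarrow> conn a m \<le> 1 / real (Suc a)"
proof -
  assume "1 \<le> m"
  then have "conn a m \<le> (1 - t) / (real (Suc a) - t)"
    using conn_antimono[of 1 m a] by (simp add: conn_sym[of a] conn_1)
  also have "\<dots> \<le> 1 / real (Suc a)"
    using t_pos less_Suc'[of a] by (simp add: field_simps)
  finally show ?thesis .
qed

lemma conn_tendsto: "1 \<le> m \<Longrightarrow> (\<lambda>a. conn a m) \<longlonglongrightarrow> 0"
  by (rule tendsto_sandwich[OF _ _ tendsto_const LIMSEQ_inverse_real_of_nat])
     (use conn_nonneg conn_le in \<open>auto simp: inverse_eq_divide\<close>)

lemma conn_log_nonneg: "0 \<le> conn_log a m"
  unfolding conn_log_def using t_pos less_Suc_add
  by (intro sum_nonneg divide_nonneg_nonneg) (auto simp: less_imp_le)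

lemma conn_log_0 [simp]: "conn_log 0 m = 0"
  by (simp add: conn_log_def)

lemma conn_log_Suc: "conn_log (Suc a) m = conn_log a m + t / (real (Suc (m + a)) - t)"
  by (simp add: conn_log_def)

lemma conn_log_Suc': "conn_log a (Suc m) + t / (real (Suc m) - t) = conn_log a m + t / (real (Suc (m + a)) - t)"
  using sum.lessThan_Suc_shift[of "\<lambda>b. t / (real (Suc (m + b)) - t)" a]
  by (simp add: conn_log_def)

text \<open>As \<open>m \<ge> 1\<close> and \<open>t < 1\<close>, the denominators are at least
  \<open>b + 1\<close>, so the growth is at most that of the harmonic numbers.\<close>

lemma conn_log_le: "1 \<le> m \<Longrightarrow> conn_log a m \<le> harm a"
  unfolding conn_log_def harm_def
proof -
  assume m: "1 \<le> m"
  have "(\<Sum>b<a. t / (real (Suc (m + b)) - t)) \<le> (\<Sum>b<a. inverse (real (Suc b)))"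
  proof (rule sum_mono)
    fix b
    have "t * (1 + real b) \<le> 1 * (1 + real b)"
      using t_less by (intro mult_right_mono) auto
    moreover have "1 + real b \<le> real (Suc (m + b)) - t"
      using m t_less by simp
    ultimately show "t / (real (Suc (m + b)) - t) \<le> inverse (real (Suc b))"
      using less_Suc[of "m + b"] by (simp add: field_simps)
  qed
  also have "\<dots> = (\<Sum>b = 1..a. inverse (real b))"
    by (rule sum.reindex_bij_witness[of _ "\<lambda>b. b - 1" Suc]) auto
  finally show "(\<Sum>b<a. t / (real (Suc (m + b)) - t)) \<le> (\<Sum>b = 1..a. inverse (of_nat b))" .
qed

text \<open>The connector decays like 1/a, while its logarithmic derivative grows at most like log
  a.\<close>

lemma conn_conn_log_tendsto:
  assumes "1 \<le> m"
  shows "(\<lambda>a. conn a m * conn_log a m) \<longlonglongrightarrow> 0"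
proof (rule tendsto_sandwich[OF _ _ tendsto_const])
  show "\<forall>\<^sub>F a in sequentially. 0 \<le> conn a m * conn_log a m"
    using conn_nonneg conn_log_nonneg by auto
  have "conn a m * conn_log a m \<le> (1 + ln (real a)) / real a" if "0 < a" for a
  proof -
    have "conn a m \<le> 1 / real a"
      using conn_le[OF assms, of a] that by (smt (verit) frac_le of_nat_0_less_iff of_nat_Suc)
    \<comment> \<open>The sequence \<open>harm a - ln a\<close> decreases and equals 1 at
      \<open>a = 1\<close>.\<close>
    moreover have "conn_log a m \<le> 1 + ln (real a)"
      using conn_log_le[OF assms, of a] euler_mascheroni_sequence_decreasing[of 1 a] that by (simp add: harm_expand(2))
    ultimately have "conn a m * conn_log a m \<le> 1 / real a * (1 + ln (real a))"
      using conn_log_nonneg by (intro mult_mono) auto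
    then show ?thesis by simp
  qed
  then show "\<forall>\<^sub>F a in sequentially. conn a m * conn_log a m \<le> (1 + ln (real a)) / real a"
    by (intro eventually_mono[OF eventually_gt_at_top[of 0]])
  show "(\<lambda>a. (1 + ln (real a)) / real a) \<longlonglongrightarrow> 0"
    using tendsto_add[OF lim_inverse_n' lim_ln_over_n] by (simp add: add_divide_distrib)
qed

text \<open>In the other variable the logarithmic derivative stays bounded by its value at
  \<open>m = 0\<close>, so the decay of the connector suffices.\<close>

lemma conn_log_tendsto: "(\<lambda>m. conn a m * conn_log a m) \<longlonglongrightarrow> 0" if "1 \<le> a"
proof (rule tendsto_sandwich[OF _ _ tendsto_const])
  show "\<forall>\<^sub>F m in sequentially. 0 \<le> conn a m * conn_log a m"
    using conn_nonneg conn_log_nonneg by auto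
  have "conn a m * conn_log a m \<le> conn m a * conn_log a 0" for m
  proof -
    have "conn_log a m \<le> conn_log a 0"
      unfolding conn_log_def
      using t_pos less_Suc' less_Suc_add by (intro sum_mono divide_left_mono mult_pos_pos) auto
    then show ?thesis
      unfolding conn_sym[of m a] by (intro mult_left_mono conn_nonneg)
  qed
  then show "\<forall>\<^sub>F m in sequentially. conn a m * conn_log a m \<le> conn m a * conn_log a 0"
    by simp
  show "(\<lambda>m. conn m a * conn_log a 0) \<longlonglongrightarrow> 0"
    using tendsto_mult_right[OF conn_tendsto[OF that], of "conn_log a 0"] by (simp add: mult.commute)
qed

section \<open>Transport identities for a single summation variable\<close>

definition g :: "nat \<Rightarrow> ennreal" where "g a = ennreal (t / (real a - t))"

text \<open>The geometric series of \<open>(t / a) ^ k\<close> over exponents from 1 on is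
  \<open>g a\<close>; if the exponent is at least 2, it is \<open>g a * h a\<close>.\<close>

definition h :: "nat \<Rightarrow> ennreal" where "h a = ennreal (t / real a)"

text \<open>The fixed index comes first, so that \<open>Conn m\<close> is a function of
  \<open>a\<close> on which summation operators act.\<close>

definition Conn :: "nat \<Rightarrow> nat \<Rightarrow> ennreal" where "Conn m a = ennreal (conn a m)"

text \<open>This is t times the derivative at x = 0 of the deformed connector itself.\<close>

definition Conn_deriv :: "nat \<Rightarrow> nat \<Rightarrow> ennreal" where "Conn_deriv m a = ennreal (conn a m * conn_log a m)"

lemma h_mult: "0 \<le> x \<Longrightarrow> h a * ennreal x = ennreal (t / real a * x)"
  using t_pos by (simp add: h_def flip: ennreal_mult)

lemma g_mult: "0 \<le> x \<Longrightarrow> k < a \<Longrightarrow> g a * ennreal x = ennreal (t / (real a - t) * x)"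
  using t_pos less_Suc[of "a - 1"] by (simp add: g_def flip: ennreal_mult)

text \<open>By \<open>conn_step\<close> each term is \<open>t / m\<close> times a difference of
  connector values: a summed entry on one side becomes a factor \<open>h m\<close> on the
  other.\<close>

lemma nsum_g_Conn:
  assumes "1 \<le> m"
  shows "(\<Sum>\<^sup>+a. of_bool (k < a) * (g a * Conn m a)) = h m * Conn m k"
proof -
  have "(\<Sum>\<^sup>+a. of_bool (k < a) * ennreal (t / (real a - t) * conn a m)) = ennreal (t / real m * conn k m)"
  proof (rule nsum_telescope)
    fix k
    show "t / (real (Suc k) - t) * conn (Suc k) m = t / real m * conn k m - t / real m * conn (Suc k) m"
      using arg_cong[OF conn_step[of k m], of "\<lambda>x. t / real m * x"] assms
      by (simp add: right_diff_distrib)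
    show "0 \<le> t / (real (Suc k) - t) * conn (Suc k) m"
      using t_pos less_Suc[of k] conn_nonneg by simp
  next
    show "(\<lambda>k. t / real m * conn k m) \<longlonglongrightarrow> 0"
      using tendsto_mult_left[OF conn_tendsto[OF assms], of "t / real m"] by simp
  qed
  moreover have "of_bool (k < a) * (g a * Conn m a) = of_bool (k < a) * ennreal (t / (real a - t) * conn a m)" for a
    using conn_nonneg by (cases "k < a") (simp_all add: Conn_def g_mult)
  ultimately show ?thesis
    using conn_nonneg by (simp add: Conn_def h_mult)
qed

lemma nsum_g_Conn':
  assumes "1 \<le> a"
  shows "(\<Sum>\<^sup>+m'. of_bool (m < m') * (g m' * Conn m' a)) = h a * Conn m a"
  using nsum_g_Conn[OF assms, of m] by (simp add: Conn_def conn_sym)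

text \<open>For the deformed connector the factor on the right is t/(m-x). Its derivative at x = 0,
  times t, is the origin of the term with \<open>h m * h m\<close>.\<close>

lemma nsum_g_Conn_deriv:
  assumes "1 \<le> m"
  shows "(\<Sum>\<^sup>+a. of_bool (k < a) * (g a * Conn_deriv m a)) = h m * Conn_deriv m k + h m * h m * Conn m k"
proof -
  \<comment> \<open>The potential is the claimed right-hand side as a real number.\<close>
  define u where "u k = t / real m * (conn k m * conn_log k m) + (t / real m)\<^sup>2 * conn k m" for k
  have "(\<Sum>\<^sup>+a. of_bool (k < a) * ennreal (t / (real a - t) * (conn a m * conn_log a m))) = ennreal (u k)"
  proof (rule nsum_telescope)
    fix k
    define p where "p = real (Suc k) - t"
    define q where "q = real (Suc (k + m)) - t"
    have pq: "p > 0" "q > 0" "q = p + m"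
      using less_Suc[of k] less_Suc[of "k + m"] by (auto simp: p_def q_def)
    have shift: "conn k m = conn (Suc k) m * q / p"
      using conn_Suc[of k m] pq by (simp add: p_def q_def field_simps)
    have shift_log: "conn_log (Suc k) m = conn_log k m + t / q"
      by (simp add: conn_log_Suc q_def add.commute)
    show "t / (real (Suc k) - t) * (conn (Suc k) m * conn_log (Suc k) m) = u k - u (Suc k)"
      unfolding u_def shift shift_log p_def[symmetric] pq(3)
      by (rule telescope_identity1) (use pq assms in auto)
    show "0 \<le> t / (real (Suc k) - t) * (conn (Suc k) m * conn_log (Suc k) m)"
      using t_pos less_Suc[of k] conn_nonneg conn_log_nonneg by simp
  next
    show "u \<longlonglongrightarrow> 0"
      unfolding u_def
      using tendsto_add[OF tendsto_mult_left[OF conn_conn_log_tendsto[OF assms], of "t / real m"]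
          tendsto_mult_left[OF conn_tendsto[OF assms], of "(t / real m)\<^sup>2"]] by simp
  qed
  moreover have "of_bool (k < a) * (g a * Conn_deriv m a) =
      of_bool (k < a) * ennreal (t / (real a - t) * (conn a m * conn_log a m))" for a
    using conn_nonneg conn_log_nonneg by (cases "k < a") (simp_all add: Conn_deriv_def g_mult)
  moreover have "ennreal (u k) = h m * Conn_deriv m k + h m * h m * Conn m k"
    using t_pos conn_nonneg conn_log_nonneg
    by (simp add: u_def Conn_def Conn_deriv_def h_mult mult.assoc power2_eq_square flip: ennreal_plus)
  ultimately show ?thesis by simp
qed

text \<open>In this direction the deformation sits inside the sum, in t/(m'-t-x), whose derivative
  gives the additional \<open>g m'\<close> on the left.\<close>

lemma nsum_g_Conn_deriv':
  assumes "1 \<le> a"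
  shows "(\<Sum>\<^sup>+m'. of_bool (m < m') * (g m' * (Conn_deriv m' a + g m' * Conn m' a))) = h a * Conn_deriv m a"
proof -
  define u where "u m = t / real a * (conn a m * conn_log a m)" for m
  have "(\<Sum>\<^sup>+m'. of_bool (m < m') * ennreal (t / (real m' - t) *
      (conn a m' * conn_log a m' + t / (real m' - t) * conn a m'))) = ennreal (u m)"
  proof (rule nsum_telescope)
    fix m
    define p where "p = real (Suc m) - t"
    define q where "q = real (Suc (m + a)) - t"
    have pq: "p > 0" "q > 0" "q = p + a"
      using less_Suc[of m] less_Suc[of "m + a"] by (auto simp: p_def q_def)
    have shift: "conn a m = conn a (Suc m) * q / p"
      using conn_Suc[of m a] pq by (simp add: conn_sym[of a] p_def q_def field_simps)
    have shift_log: "conn_log a m = conn_log a (Suc m) + t / p - t / q"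
      using conn_log_Suc'[of a m] by (simp add: p_def q_def)
    show "t / (real (Suc m) - t) *
      (conn a (Suc m) * conn_log a (Suc m) + t / (real (Suc m) - t) * conn a (Suc m)) = u m - u (Suc m)"
      unfolding u_def shift shift_log p_def[symmetric] pq(3)
      by (rule telescope_identity2) (use pq assms in auto)
    show "0 \<le> t / (real (Suc m) - t) *
      (conn a (Suc m) * conn_log a (Suc m) + t / (real (Suc m) - t) * conn a (Suc m))"
      using t_pos less_Suc[of m] conn_nonneg conn_log_nonneg by simp
  next
    show "u \<longlonglongrightarrow> 0"
      unfolding u_def
      using tendsto_mult_left[OF conn_log_tendsto[OF assms], of "t / real a"] by simp
  qed
  moreover have "of_bool (m < m') * (g m' * (Conn_deriv m' a + g m' * Conn m' a)) =
      of_bool (m < m') * ennreal (t / (real m' - t) *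
      (conn a m' * conn_log a m' + t / (real m' - t) * conn a m'))" for m'
    using t_pos conn_nonneg conn_log_nonneg less_Suc[of "m' - 1"]
    by (cases "m < m'") (simp_all add: Conn_deriv_def Conn_def g_mult flip: ennreal_plus)
  moreover have "ennreal (u m) = h a * Conn_deriv m a"
    using conn_nonneg conn_log_nonneg by (simp add: u_def Conn_deriv_def h_mult)
  ultimately show ?thesis by simp
qed

end

section \<open>Transport of connected sums\<close>

definition tail_sum :: "(nat \<Rightarrow> ennreal) \<Rightarrow> (nat \<Rightarrow> ennreal) \<Rightarrow> nat \<Rightarrow> ennreal" where
  "tail_sum g \<psi> k = (\<Sum>\<^sup>+a. of_bool (k < a) * (g a * \<psi> a))"

lemma tail_sum_cong: "(\<And>a. 0 < a \<Longrightarrow> \<psi> a = \<psi>' a) \<Longrightarrow> tail_sum g \<psi> = tail_sum g \<psi>'"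
  unfolding tail_sum_def by (intro ext nsum_cong) auto

lemma tail_sum_add: "tail_sum g (\<lambda>a. \<phi> a + \<psi> a) = (\<lambda>k. tail_sum g \<phi> k + tail_sum g \<psi> k)"
  unfolding tail_sum_def by (simp add: distrib_left nsum_add)

lemma tail_sum_nsum: "tail_sum g (\<lambda>a. \<Sum>\<^sup>+j. d j * \<phi> j a) = (\<lambda>k. \<Sum>\<^sup>+j. d j * tail_sum g (\<phi> j) k)"
proof
  fix k
  have "tail_sum g (\<lambda>a. \<Sum>\<^sup>+j. d j * \<phi> j a) k = (\<Sum>\<^sup>+a. \<Sum>\<^sup>+j. of_bool (k < a) * (g a * (d j * \<phi> j a)))"
    unfolding tail_sum_def by (simp add: nsum_cmult)
  also have "\<dots> = (\<Sum>\<^sup>+j. \<Sum>\<^sup>+a. d j * (of_bool (k < a) * (g a * \<phi> j a)))"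
    by (subst nsum_swap) (simp add: mult_ac)
  finally show "tail_sum g (\<lambda>a. \<Sum>\<^sup>+j. d j * \<phi> j a) k = (\<Sum>\<^sup>+j. d j * tail_sum g (\<phi> j) k)"
    unfolding tail_sum_def by (simp add: nsum_cmult)
qed

lemma tail_sum_cmult: "tail_sum g (\<lambda>a. d * \<phi> a) = (\<lambda>k. d * tail_sum g \<phi> k)"
  unfolding tail_sum_def by (simp add: mult.left_commute nsum_cmult)

lemma tail_sum_pow_add: "(tail_sum g ^^ n) (\<lambda>a. \<phi> a + \<psi> a) = (\<lambda>k. (tail_sum g ^^ n) \<phi> k + (tail_sum g ^^ n) \<psi> k)"
  by (induction n) (simp_all add: tail_sum_add)

lemma tail_sum_pow_nsum: "(tail_sum g ^^ n) (\<lambda>a. \<Sum>\<^sup>+j. d j * \<phi> j a) = (\<lambda>k. \<Sum>\<^sup>+j. d j * (tail_sum g ^^ n) (\<phi> j) k)"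
  by (induction n) (simp_all add: tail_sum_nsum)

text \<open>One application of \<open>tail_sum\<close> already restricts the argument to positive
  numbers, where the transport identities are available.\<close>

lemma tail_sum_pow_Suc_cong:
  "(\<And>a. 0 < a \<Longrightarrow> \<psi> a = \<psi>' a) \<Longrightarrow> (tail_sum g ^^ Suc n) \<psi> = (tail_sum g ^^ Suc n) \<psi>'"
  by (simp add: funpow_swap1 tail_sum_cong[of \<psi> \<psi>'])

lemma tail_sum_pow_list:
  "(\<Sum>\<^sup>+xs. of_bool (length xs = Suc n \<and> sorted_wrt (<) (k # xs)) * (prod_list (map g xs) * \<psi> (last xs)))
   = (tail_sum g ^^ Suc n) \<psi> k"
proof (induction n arbitrary: k)
  case 0
  have "(\<Sum>\<^sup>+xs. of_bool (length (x # xs) = Suc 0 \<and> sorted_wrt (<) (k # x # xs)) *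
      (prod_list (map g (x # xs)) * \<psi> (last (x # xs)))) = of_bool (k < x) * (g x * \<psi> x)" for x
  proof -
    have "(\<Sum>\<^sup>+xs. of_bool (length (x # xs) = Suc 0 \<and> sorted_wrt (<) (k # x # xs)) *
      (prod_list (map g (x # xs)) * \<psi> (last (x # xs)))) =
      (\<Sum>\<^sup>+xs::nat list. of_bool (xs = []) * (of_bool (k < x) * (g x * \<psi> x)))"
      by (rule nsum_cong) auto
    then show ?thesis by (simp only: nsum_delta)
  qed
  then show ?case by (subst nsum_list) (simp add: tail_sum_def)
next
  case (Suc n)
  have "(\<Sum>\<^sup>+xs. of_bool (length xs = Suc (Suc n) \<and> sorted_wrt (<) (k # xs)) * (prod_list (map g xs) * \<psi> (last xs)))
    = (\<Sum>\<^sup>+x. \<Sum>\<^sup>+xs. (of_bool (k < x) * g x) *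
        (of_bool (length xs = Suc n \<and> sorted_wrt (<) (x # xs)) * (prod_list (map g xs) * \<psi> (last xs))))"
    by (subst nsum_list) (simp, intro nsum_cong, auto simp: mult.assoc, meson order.strict_trans)
  also have "\<dots> = (tail_sum g ^^ Suc (Suc n)) \<psi> k"
    unfolding nsum_cmult Suc by (simp add: tail_sum_def mult.assoc)
  finally show ?case .
qed

section \<open>Weighted chains and the operator that sums one chain\<close>

locale weighted_chains = generating_variable +
  fixes r :: nat
begin

text \<open>The leading 0 makes the entries positive and makes a chain the case \<open>k = 0\<close>
  of the range in \<open>Block\<close>.\<close>

definition chain :: "nat list \<Rightarrow> bool" where
  "chain xs \<longleftrightarrow> length xs = Suc r \<and> sorted_wrt (<) (0 # xs)"

definition chain_weight :: "nat list \<Rightarrow> ennreal" where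
  "chain_weight xs = prod_list (map g xs) * h (last xs)"

definition Block :: "(nat \<Rightarrow> ennreal) \<Rightarrow> nat \<Rightarrow> ennreal" where
  "Block \<phi> k = (\<Sum>\<^sup>+xs. of_bool (length xs = Suc r \<and> sorted_wrt (<) (k # xs)) * (chain_weight xs * \<phi> (last xs)))"

definition lam :: "nat \<Rightarrow> ennreal" where "lam m = h m ^ Suc r * g m"

definition del :: "nat \<Rightarrow> ennreal" where "del m = of_nat (Suc r) * h m + g m"

lemma Block_eq: "Block \<phi> = (tail_sum g ^^ Suc r) (\<lambda>a. h a * \<phi> a)"
  unfolding Block_def tail_sum_pow_list[symmetric] by (simp add: chain_weight_def mult.assoc)

lemma Block_add: "Block (\<lambda>a. \<phi> a + \<psi> a) = (\<lambda>k. Block \<phi> k + Block \<psi> k)"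
  unfolding Block_eq distrib_left by (rule tail_sum_pow_add)

lemma Block_nsum: "Block (\<lambda>a. \<Sum>\<^sup>+j. d j * \<phi> j a) = (\<lambda>k. \<Sum>\<^sup>+j. d j * Block (\<phi> j) k)"
proof -
  have "h a * (\<Sum>\<^sup>+j. d j * \<phi> j a) = (\<Sum>\<^sup>+j. d j * (h a * \<phi> j a))" for a
    by (simp add: mult.left_commute flip: nsum_cmult)
  then show ?thesis by (simp add: Block_eq tail_sum_pow_nsum del: funpow.simps)
qed

lemma Block_pow_add: "(Block ^^ n) (\<lambda>a. \<phi> a + \<psi> a) = (\<lambda>k. (Block ^^ n) \<phi> k + (Block ^^ n) \<psi> k)"
  by (induction n) (simp_all add: Block_add)

lemma Block_pow_nsum:
  "(Block ^^ n) (\<lambda>a. \<Sum>\<^sup>+j. d j * \<phi> j a) = (\<lambda>k. \<Sum>\<^sup>+j. d j * (Block ^^ n) (\<phi> j) k)"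
  by (induction n) (simp_all add: Block_nsum)

lemma tail_sum_pow_Conn: "1 \<le> m \<Longrightarrow> (tail_sum g ^^ n) (Conn m) = (\<lambda>k. h m ^ n * Conn m k)"
proof (induction n)
  case (Suc n)
  have "tail_sum g (Conn m) = (\<lambda>k. h m * Conn m k)"
    using nsum_g_Conn[OF Suc.prems] by (simp add: tail_sum_def fun_eq_iff)
  then show ?case by (simp add: Suc.IH[OF Suc.prems] tail_sum_cmult) (simp add: mult_ac)
qed simp

lemma tail_sum_pow_Conn_deriv: "1 \<le> m \<Longrightarrow>
  (tail_sum g ^^ n) (Conn_deriv m) = (\<lambda>k. h m ^ n * Conn_deriv m k + of_nat n * h m ^ Suc n * Conn m k)"
proof (induction n)
  case (Suc n)
  have "tail_sum g (Conn m) = (\<lambda>k. h m * Conn m k)"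
    using nsum_g_Conn[OF Suc.prems] by (simp add: tail_sum_def fun_eq_iff)
  moreover have "tail_sum g (Conn_deriv m) = (\<lambda>k. h m * Conn_deriv m k + h m * h m * Conn m k)"
    using nsum_g_Conn_deriv[OF Suc.prems] by (simp add: tail_sum_def fun_eq_iff)
  ultimately show ?case
    by (simp add: Suc.IH[OF Suc.prems] tail_sum_add tail_sum_cmult) (simp add: algebra_simps)
qed simp

text \<open>The factor \<open>h a\<close> of the maximum is expanded into a new index
  \<open>j > m\<close> with weight \<open>g j\<close>; each of the \<open>r + 1\<close> sums over
  the entries then returns a factor \<open>h j\<close>. Together these make up
  \<open>lam j\<close>.\<close>

lemma Block_Conn: "Block (Conn m) = (\<lambda>a. \<Sum>\<^sup>+j. of_bool (m < j) * lam j * Conn j a)"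
proof -
  have "Block (Conn m) = (tail_sum g ^^ Suc r) (\<lambda>a. \<Sum>\<^sup>+j. (of_bool (m < j) * g j) * Conn j a)"
    unfolding Block_eq by (rule tail_sum_pow_Suc_cong) (simp add: nsum_g_Conn'[symmetric] mult.assoc)
  also have "\<dots> = (\<lambda>k. \<Sum>\<^sup>+j. (of_bool (m < j) * g j) * (tail_sum g ^^ Suc r) (Conn j) k)"
    by (rule tail_sum_pow_nsum)
  also have "\<dots> = (\<lambda>a. \<Sum>\<^sup>+j. of_bool (m < j) * lam j * Conn j a)"
  proof (intro ext nsum_cong)
    fix k j
    show "(of_bool (m < j) * g j) * (tail_sum g ^^ Suc r) (Conn j) k = of_bool (m < j) * lam j * Conn j k"
      by (cases "m < j") (simp_all add: tail_sum_pow_Conn lam_def mult_ac del: funpow.simps)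
  qed
  finally show ?thesis .
qed

text \<open>The same transport for the derivative. The \<open>r + 1\<close> sums over entries
  contribute one extra \<open>h j\<close> each and the passage to \<open>j\<close> one extra
  \<open>g j\<close>, which is how \<open>del j\<close> arises.\<close>

lemma Block_Conn_deriv:
  "Block (Conn_deriv m) = (\<lambda>a. (\<Sum>\<^sup>+j. of_bool (m < j) * lam j * Conn_deriv j a) +
     (\<Sum>\<^sup>+j. of_bool (m < j) * lam j * del j * Conn j a))"
proof -
  have "Block (Conn_deriv m) = (tail_sum g ^^ Suc r) (\<lambda>a. \<Sum>\<^sup>+j. (of_bool (m < j) * g j) * (Conn_deriv j a + g j * Conn j a))"
    unfolding Block_eq by (rule tail_sum_pow_Suc_cong) (simp add: nsum_g_Conn_deriv'[symmetric] mult.assoc)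
  also have "\<dots> = (\<lambda>k. \<Sum>\<^sup>+j. (of_bool (m < j) * g j) * (tail_sum g ^^ Suc r) (\<lambda>a. Conn_deriv j a + g j * Conn j a) k)"
    by (rule tail_sum_pow_nsum)
  also have "\<dots> = (\<lambda>a. \<Sum>\<^sup>+j. of_bool (m < j) * lam j * Conn_deriv j a + of_bool (m < j) * lam j * del j * Conn j a)"
  proof (intro ext nsum_cong)
    fix k j
    have "(tail_sum g ^^ Suc r) (\<lambda>a. g j * Conn j a) = (\<lambda>k. g j * (tail_sum g ^^ Suc r) (Conn j) k)"
      by (induction r) (simp_all add: tail_sum_cmult)
    then show "(of_bool (m < j) * g j) * (tail_sum g ^^ Suc r) (\<lambda>a. Conn_deriv j a + g j * Conn j a) k =
        of_bool (m < j) * lam j * Conn_deriv j k + of_bool (m < j) * lam j * del j * Conn j k"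
      by (cases "m < j")
         (simp_all add: tail_sum_pow_add tail_sum_pow_Conn tail_sum_pow_Conn_deriv lam_def del_def algebra_simps del: funpow.simps)
  qed
  finally show ?thesis by (simp add: nsum_add)
qed

section \<open>Elementary symmetric functions in the \<open>lam j\<close> and the values of iterated
  blocks\<close>

primrec elem_sum :: "nat \<Rightarrow> nat \<Rightarrow> ennreal" where
  "elem_sum 0 m = 1"
| "elem_sum (Suc q) m = (\<Sum>\<^sup>+j. of_bool (m < j) * (lam j * elem_sum q j))"

text \<open>
  \<open>mixed_sum n q m\<close> is the sum over all $i > m$ of \<open>del i * lam i ^ n\<close> times the elementary
  symmetric function of degree \<open>q\<close> in the \<open>lam j\<close> with $j > m$ and $j \ne i$. The recursion
  removes the smallest index.
\<close>

primrec mixed_sum :: "nat \<Rightarrow> nat \<Rightarrow> nat \<Rightarrow> ennreal" where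
  "mixed_sum n 0 m = (\<Sum>\<^sup>+j. of_bool (m < j) * (del j * lam j ^ n))"
| "mixed_sum n (Suc q) m = (\<Sum>\<^sup>+j. of_bool (m < j) * (lam j * mixed_sum n q j + del j * lam j ^ n * elem_sum (Suc q) j))"

lemma Conn_0 [simp]: "Conn m 0 = 1" by (simp add: Conn_def)
lemma Conn_deriv_0 [simp]: "Conn_deriv m 0 = 0" by (simp add: Conn_deriv_def)

text \<open>Each transport turns the innermost chain into one index \<open>j\<close>; at the end the
  connector is evaluated at 0, where it is 1.\<close>

lemma Block_pow_Conn: "(Block ^^ q) (Conn m) 0 = elem_sum q m"
proof (induction q arbitrary: m)
  case (Suc q)
  have "(Block ^^ Suc q) (Conn m) 0 = (Block ^^ q) (Block (Conn m)) 0"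
    by (simp add: funpow_swap1)
  also have "\<dots> = elem_sum (Suc q) m"
    unfolding Block_Conn Block_pow_nsum Suc by (simp add: mult.assoc)
  finally show ?case .
qed simp

text \<open>Since \<open>Conn_deriv\<close> vanishes at 0, only terms survive in which exactly one
  transport has produced a factor \<open>del\<close>.\<close>

lemma Block_pow_Conn_deriv: "(Block ^^ Suc q) (Conn_deriv m) 0 = mixed_sum 1 q m"
proof (induction q arbitrary: m)
  case 0
  then show ?case
    by (simp add: Block_Conn_deriv mult.assoc mult.commute[of "del _"])
next
  case (Suc q)
  have "(Block ^^ Suc (Suc q)) (Conn_deriv m) 0 = (Block ^^ Suc q) (Block (Conn_deriv m)) 0"
    by (simp add: funpow_swap1)
  also have "\<dots> = mixed_sum 1 (Suc q) m"
    unfolding Block_Conn_deriv Block_pow_add Block_pow_nsum Suc Block_pow_Conn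
    by (simp add: algebra_simps nsum_add del: elem_sum.simps)
  finally show ?case .
qed

text \<open>The index \<open>i\<close> of the power sum is compared with the smallest index
  \<open>j\<close> of the elementary symmetric function: the three terms are \<open>j < i\<close>,
  \<open>j = i\<close> and \<open>i < j\<close>.\<close>

lemma mixed_sum_0_mult_elem_sum: "mixed_sum n 0 m * elem_sum (Suc q) m =
    (\<Sum>\<^sup>+j. of_bool (m < j) * (lam j * (elem_sum q j * mixed_sum n 0 j) + del j * lam j ^ n * (lam j * elem_sum q j)
       + del j * lam j ^ n * elem_sum (Suc q) j))"
proof -
  have "mixed_sum n 0 m * elem_sum (Suc q) m = (\<Sum>\<^sup>+i. \<Sum>\<^sup>+j. of_bool (m < i) * (del i * lam i ^ n) * (of_bool (m < j) * (lam j * elem_sum q j)))"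
    by (simp add: nsum_cmult nsum_multc)
  also have "\<dots> = (\<Sum>\<^sup>+i. \<Sum>\<^sup>+j. of_bool (m < j) * (lam j * elem_sum q j) * (of_bool (j < i) * (del i * lam i ^ n))
      + of_bool (j = i) * (of_bool (m < j) * (lam j * elem_sum q j) * (del j * lam j ^ n))
      + of_bool (m < i) * (del i * lam i ^ n) * (of_bool (i < j) * (lam j * elem_sum q j)))"
    by (intro nsum_cong) (auto simp: mult_ac)
  also have "\<dots> = (\<Sum>\<^sup>+i. \<Sum>\<^sup>+j. of_bool (m < j) * (lam j * elem_sum q j) * (of_bool (j < i) * (del i * lam i ^ n)))
     + (\<Sum>\<^sup>+j. of_bool (m < j) * (lam j * elem_sum q j) * (del j * lam j ^ n))
     + (\<Sum>\<^sup>+i. of_bool (m < i) * (del i * lam i ^ n) * elem_sum (Suc q) i)"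
    by (simp add: nsum_add nsum_cmult)
  also have "(\<Sum>\<^sup>+i. \<Sum>\<^sup>+j. of_bool (m < j) * (lam j * elem_sum q j) * (of_bool (j < i) * (del i * lam i ^ n)))
    = (\<Sum>\<^sup>+j. of_bool (m < j) * (lam j * elem_sum q j) * mixed_sum n 0 j)"
    by (subst nsum_swap) (simp add: nsum_cmult)
  finally show ?thesis
    by (simp add: algebra_simps nsum_add del: elem_sum.simps mixed_sum.simps)
qed

text \<open>A Newton identity: the index of the power sum is either distinct from the
  \<open>q + 1\<close> others or one of them, and then the power of its \<open>lam\<close> rises by
  one.\<close>

lemma mixed_sum_rec: "mixed_sum n (Suc q) m + mixed_sum (Suc n) q m = mixed_sum n 0 m * elem_sum (Suc q) m"
proof (induction q arbitrary: m)
  case 0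
  show ?case unfolding mixed_sum_0_mult_elem_sum
    by (simp add: algebra_simps nsum_add del: elem_sum.simps(2) mixed_sum.simps(1))
       (simp add: algebra_simps nsum_add del: elem_sum.simps(2))
next
  case (Suc q)
  have IH: "elem_sum (Suc q) j * mixed_sum n 0 j = mixed_sum n (Suc q) j + mixed_sum (Suc n) q j" for j
    using Suc[of j] by (simp only: mult.commute)
  show ?case
    unfolding mixed_sum_0_mult_elem_sum IH mixed_sum.simps(2)[of n "Suc q" m] mixed_sum.simps(2)[of "Suc n" q m]
    by (simp add: algebra_simps del: elem_sum.simps mixed_sum.simps flip: nsum_add)
qed

end

section \<open>Ribbons of chains\<close>

context weighted_chains
begin

primrec stack :: "nat \<Rightarrow> nat \<Rightarrow> ennreal" where
  "stack 0 m = 1"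
| "stack (Suc q) m = (\<Sum>\<^sup>+xs. of_bool (chain xs \<and> last xs < m) * (chain_weight xs * stack q (hd xs)))"

definition join :: "(nat \<Rightarrow> ennreal) \<Rightarrow> nat \<Rightarrow> ennreal" where
  "join f b = (\<Sum>\<^sup>+xs. of_bool (chain xs \<and> b \<le> last xs) * (chain_weight xs * f (hd xs)))"

text \<open>
  \<open>n\<close> weakly linked chains, the last of which is followed by \<open>q\<close> strictly linked ones.
\<close>

definition ribbon :: "nat \<Rightarrow> nat \<Rightarrow> ennreal" where
  "ribbon n q = (\<Sum>\<^sup>+b. of_bool (0 < b) * (g b * (join ^^ n) (stack q) b))"

text \<open>The top chain is summed first. Lying strictly above \<open>last ys\<close>, it
  contributes \<open>Block \<phi> (last ys)\<close>, which takes over the role of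
  \<open>\<phi>\<close> for the chain below.\<close>

lemma chain_Block:
  "(\<Sum>\<^sup>+xs. of_bool (chain xs) * (chain_weight xs * (\<phi> (last xs) * stack q (hd xs)))) = (Block ^^ Suc q) \<phi> 0"
proof (induction q arbitrary: \<phi>)
  case 0
  show ?case by (simp add: Block_def chain_def)
next
  case (Suc q)
  have "(\<Sum>\<^sup>+xs. of_bool (chain xs) * (chain_weight xs * (\<phi> (last xs) * stack (Suc q) (hd xs)))) =
    (\<Sum>\<^sup>+xs. \<Sum>\<^sup>+ys. of_bool (chain xs) * (chain_weight xs * \<phi> (last xs)) *
      (of_bool (chain ys \<and> last ys < hd xs) * (chain_weight ys * stack q (hd ys))))"
    by (simp add: nsum_cmult mult.assoc)
  also have "\<dots> = (\<Sum>\<^sup>+ys. \<Sum>\<^sup>+xs. (of_bool (chain ys) * (chain_weight ys * stack q (hd ys))) *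
      (of_bool (length xs = Suc r \<and> sorted_wrt (<) (last ys # xs)) * (chain_weight xs * \<phi> (last xs))))"
  proof (subst nsum_swap, intro nsum_cong)
    fix xs ys
    have "chain ys \<and> last ys < hd xs \<and> chain xs \<longleftrightarrow>
        chain ys \<and> length xs = Suc r \<and> sorted_wrt (<) (last ys # xs)"
      by (cases xs) (auto simp: chain_def)
    then show "of_bool (chain xs) * (chain_weight xs * \<phi> (last xs)) *
        (of_bool (chain ys \<and> last ys < hd xs) * (chain_weight ys * stack q (hd ys))) =
      (of_bool (chain ys) * (chain_weight ys * stack q (hd ys))) *
        (of_bool (length xs = Suc r \<and> sorted_wrt (<) (last ys # xs)) * (chain_weight xs * \<phi> (last xs)))"
      by (auto simp: mult_ac)
  qed
  also have "\<dots> = (\<Sum>\<^sup>+ys. of_bool (chain ys) * (chain_weight ys * (Block \<phi> (last ys) * stack q (hd ys))))"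
    unfolding nsum_cmult Block_def by (simp only: mult_ac)
  also have "\<dots> = (Block ^^ Suc (Suc q)) \<phi> 0"
    unfolding Suc by (simp add: funpow_swap1)
  finally show ?case .
qed

lemma join_add: "join (\<lambda>b. f b + f' b) = (\<lambda>b. join f b + join f' b)"
  unfolding join_def by (simp add: distrib_left nsum_add)

lemma join_cmult: "join (\<lambda>b. d * f b) = (\<lambda>b. d * join f b)"
  unfolding join_def by (simp add: mult.left_commute nsum_cmult)

lemma join_pow_add: "(join ^^ n) (\<lambda>b. f b + f' b) = (\<lambda>b. (join ^^ n) f b + (join ^^ n) f' b)"
  by (induction n) (simp_all add: join_add)

lemma join_pow_cmult: "(join ^^ n) (\<lambda>b. d * f b) = (\<lambda>b. d * (join ^^ n) f b)"
  by (induction n) (simp_all add: join_cmult)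

text \<open>Every chain satisfies exactly one of the two links to \<open>b\<close>, so the
  dependence on \<open>b\<close> disappears.\<close>

lemma stack_add_join: "stack (Suc q) b + join (stack q) b = elem_sum (Suc q) 0"
proof -
  \<comment> \<open>\<open>Conn 0\<close> is constantly 1; inserting it makes the evaluation of
    iterated blocks applicable.\<close>
  have "stack (Suc q) b + join (stack q) b = (\<Sum>\<^sup>+xs. of_bool (chain xs) * (chain_weight xs * (Conn 0 (last xs) * stack q (hd xs))))"
    unfolding stack.simps join_def by (subst nsum_add[symmetric], intro nsum_cong) (auto simp: Conn_def)
  also have "\<dots> = elem_sum (Suc q) 0"
    unfolding chain_Block Block_pow_Conn ..
  finally show ?thesis .
qed

text \<open>The recursion of \<open>mixed_sum_rec\<close>, now obtained by applying the linear
  operator \<open>join ^^ n\<close> to \<open>stack_add_join\<close>. Agreement of both families at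
  \<open>n = 1\<close> therefore propagates.\<close>

lemma ribbon_rec: "ribbon n (Suc q) + ribbon (Suc n) q = elem_sum (Suc q) 0 * ribbon n 0"
proof -
  have "(join ^^ n) (stack (Suc q)) b + (join ^^ Suc n) (stack q) b = elem_sum (Suc q) 0 * (join ^^ n) (stack 0) b" for b
  proof -
    have "(join ^^ n) (stack (Suc q)) b + (join ^^ Suc n) (stack q) b = (join ^^ n) (\<lambda>b. stack (Suc q) b + join (stack q) b) b"
      by (simp only: join_pow_add funpow_Suc_right o_def)
    also have "\<dots> = (join ^^ n) (\<lambda>b. elem_sum (Suc q) 0 * stack 0 b) b"
      by (simp only: stack_add_join stack.simps(1) mult_1_right)
    finally show ?thesis by (simp only: join_pow_cmult)
  qed
  note * = this
  have "ribbon n (Suc q) + ribbon (Suc n) q =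
      (\<Sum>\<^sup>+b. of_bool (0 < b) * (g b * ((join ^^ n) (stack (Suc q)) b + (join ^^ Suc n) (stack q) b)))"
    unfolding ribbon_def by (simp only: distrib_left nsum_add)
  also have "\<dots> = elem_sum (Suc q) 0 * ribbon n 0"
    unfolding * ribbon_def nsum_cmult[symmetric] by (simp only: mult_ac)
  finally show ?thesis .
qed

text \<open>At \<open>m = 0\<close> the connector is 1 and its logarithmic derivative is the sum
  over a free \<open>b\<close> up to \<open>a\<close>: this is how differentiation inserts
  \<open>b\<close>.\<close>

lemma Conn_deriv_0_eq: "Conn_deriv 0 a = (\<Sum>\<^sup>+b. of_bool (0 < b \<and> b \<le> a) * g b)"
proof (induction a)
  case (Suc a)
  have "(\<Sum>\<^sup>+b. of_bool (0 < b \<and> b \<le> Suc a) * g b) =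
      (\<Sum>\<^sup>+b. of_bool (0 < b \<and> b \<le> a) * g b + of_bool (b = Suc a) * g b)"
    by (intro nsum_cong) auto
  also have "\<dots> = Conn_deriv 0 a + g (Suc a)"
    by (simp add: nsum_add Suc)
  also have "\<dots> = Conn_deriv 0 (Suc a)"
    using t_pos less_Suc[of a] conn_log_nonneg
    by (simp add: Conn_deriv_def g_def conn_log_Suc flip: ennreal_plus)
  finally show ?case ..
next
  case 0
  have "(\<Sum>\<^sup>+b. of_bool (0 < b \<and> b \<le> 0) * g b) = (\<Sum>\<^sup>+b::nat. 0)"
    by (rule nsum_cong) auto
  then show ?case by simp
qed

text \<open>Summing over \<open>b\<close> first leaves \<open>Conn_deriv 0\<close> at the maximum of
  the top chain, whose iterated blocks are known.\<close>

lemma ribbon_1: "ribbon 1 q = mixed_sum 1 q 0"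
proof -
  have "ribbon 1 q = (\<Sum>\<^sup>+b. \<Sum>\<^sup>+xs. of_bool (0 < b) * (g b * (of_bool (chain xs \<and> b \<le> last xs) * (chain_weight xs * stack q (hd xs)))))"
    by (simp add: ribbon_def join_def nsum_cmult)
  also have "\<dots> = (\<Sum>\<^sup>+xs. \<Sum>\<^sup>+b. (of_bool (chain xs) * (chain_weight xs * stack q (hd xs))) * (of_bool (0 < b \<and> b \<le> last xs) * g b))"
    by (subst nsum_swap, intro nsum_cong) (auto simp: mult_ac)
  also have "\<dots> = (\<Sum>\<^sup>+xs. of_bool (chain xs) * (chain_weight xs * (Conn_deriv 0 (last xs) * stack q (hd xs))))"
    unfolding nsum_cmult Conn_deriv_0_eq[symmetric] by (simp only: mult_ac)
  also have "\<dots> = mixed_sum 1 q 0"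
    unfolding chain_Block Block_pow_Conn_deriv ..
  finally show ?thesis .
qed

section \<open>Finiteness of the sums\<close>

definition lam_total :: ennreal where "lam_total = (\<Sum>\<^sup>+j. of_bool (0 < j) * lam j)"

lemma h_le_1: "h m \<le> 1" if "0 < m"
  using that t_less t_pos by (simp add: h_def)

text \<open>All but one of the factors \<open>h\<close> are dropped, and the remaining one is
  bounded by a multiple of the connector at \<open>a = 1\<close>; the transport identity then sums
  the majorant in closed form.\<close>

lemma lam_total_finite: "lam_total < top"
proof -
  have "of_bool (0 < j) * lam j \<le> ennreal (2 * t / (1 - t)) * (of_bool (0 < j) * (g j * Conn j 1))" for j
  proof (cases "0 < j")
    case True
    have "h j ^ Suc r \<le> h j"
      using power_decreasing[of 1 "Suc r" "h j"] h_le_1[OF True] by simp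
    also have "h j \<le> ennreal (2 * t / (1 - t)) * Conn j 1"
    proof -
      \<comment> \<open>The constant combines \<open>j + 1 - t \<le> 2 j\<close> with the numerator
        \<open>1 - t\<close> of \<open>conn 1 j\<close>.\<close>
      have "t / j \<le> 2 * t / (1 - t) * ((1 - t) / (real (Suc j) - t))"
      proof -
        have "real (Suc j) - t \<le> 2 * real j" "0 < real (Suc j) - t"
          using True t_pos less_Suc[of j] by auto
        then have "t / j \<le> 2 * t / (real (Suc j) - t)"
          using True t_pos mult_left_mono[of _ _ t] by (simp add: divide_simps)
        also have "\<dots> = 2 * t / (1 - t) * ((1 - t) / (real (Suc j) - t))"
          using t_less by simp
        finally show ?thesis .
      qed
      then show ?thesis
        using t_pos t_less by (simp add: h_def Conn_def conn_1 conn_nonneg flip: ennreal_mult)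
    qed
    finally have "h j ^ Suc r * g j \<le> ennreal (2 * t / (1 - t)) * Conn j 1 * g j"
      by (rule mult_right_mono) simp
    with True show ?thesis by (simp add: lam_def mult_ac)
  qed simp
  then have "lam_total \<le> ennreal (2 * t / (1 - t)) * (\<Sum>\<^sup>+j. of_bool (0 < j) * (g j * Conn j 1))"
    unfolding lam_total_def nsum_cmult[symmetric] by (rule nsum_mono)
  also have "\<dots> = ennreal (2 * t / (1 - t)) * (h 1 * Conn 0 1)"
    by (subst nsum_g_Conn') auto
  also have "\<dots> < top"
    by (simp add: h_def Conn_def ennreal_mult_less_top)
  finally show ?thesis .
qed

lemma lam_le_total: "0 < j \<Longrightarrow> lam j \<le> lam_total"
  using nsum_ge[of "\<lambda>j. of_bool (0 < j) * lam j" j] by (simp add: lam_total_def)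

lemma nsum_lam_le:
  assumes "\<And>j. f j \<le> B"
  shows "(\<Sum>\<^sup>+j. of_bool (m < j) * (lam j * f j)) \<le> lam_total * B"
proof -
  have "(\<Sum>\<^sup>+j. of_bool (m < j) * (lam j * f j)) \<le> (\<Sum>\<^sup>+j. of_bool (0 < j) * lam j * B)"
    by (rule nsum_mono) (auto intro!: mult_left_mono assms)
  then show ?thesis by (simp add: lam_total_def nsum_multc)
qed

lemma elem_sum_le: "elem_sum q m \<le> lam_total ^ q"
proof (induction q arbitrary: m)
  case (Suc q)
  show ?case using nsum_lam_le[OF Suc] by simp
qed simp

definition del_bound :: ennreal where "del_bound = of_nat (Suc r) + ennreal (t / (1 - t))"

lemma del_le: "0 < j \<Longrightarrow> del j \<le> del_bound"
proof -
  assume j: "0 < j"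
  have "of_nat (Suc r) * h j \<le> of_nat (Suc r)"
    using mult_left_mono[OF h_le_1[OF j], of "of_nat (Suc r)"] by simp
  moreover have "g j \<le> ennreal (t / (1 - t))"
    using j t_pos t_less by (auto simp: g_def intro!: ennreal_leI divide_left_mono mult_pos_pos)
  ultimately show ?thesis
    unfolding del_def del_bound_def by (rule add_mono)
qed

text \<open>One factor \<open>lam j\<close> is kept for convergence and all others are bounded
  uniformly. The power must be positive, because \<open>del j\<close> alone is only of order
  1/j.\<close>

lemma mixed_sum_bounded: "\<exists>B<top. \<forall>m. mixed_sum (Suc n) q m \<le> B"
proof -
  have le: "of_bool (m < j) * (del j * lam j ^ Suc n * x) \<le> of_bool (m < j) * (lam j * (del_bound * lam_total ^ n * x))" for m j x
  proof (cases "m < j")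
    case True
    have "del j * lam j ^ n \<le> del_bound * lam_total ^ n"
      using True by (intro mult_mono del_le power_mono lam_le_total) auto
    from mult_left_mono[OF this, of "lam j * x"] True show ?thesis by (simp add: mult_ac)
  qed simp
  have del_bound: "del_bound < top" by (simp add: del_bound_def of_nat_less_top)
  show ?thesis
  proof (induction q)
    case 0
    have "mixed_sum (Suc n) 0 m \<le> lam_total * (del_bound * lam_total ^ n)" for m
    proof -
      have "mixed_sum (Suc n) 0 m \<le> (\<Sum>\<^sup>+j. of_bool (m < j) * (lam j * (del_bound * lam_total ^ n)))"
        unfolding mixed_sum.simps using le[where x = 1] by (intro nsum_mono) simp
      also have "\<dots> \<le> lam_total * (del_bound * lam_total ^ n)"
        by (rule nsum_lam_le) simp
      finally show ?thesis .
    qed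
    moreover have "lam_total * (del_bound * lam_total ^ n) < top"
      using lam_total_finite del_bound by (auto simp: ennreal_mult_less_top power_less_top_ennreal)
    ultimately show ?case by blast
  next
    case (Suc q)
    then obtain B where B: "B < top" "\<And>m. mixed_sum (Suc n) q m \<le> B" by blast
    have "mixed_sum (Suc n) (Suc q) m \<le> lam_total * (B + del_bound * lam_total ^ n * lam_total ^ Suc q)" for m
    proof -
      have "mixed_sum (Suc n) (Suc q) m \<le> (\<Sum>\<^sup>+j. of_bool (m < j) * (lam j * (mixed_sum (Suc n) q j + del_bound * lam_total ^ n * elem_sum (Suc q) j)))"
        unfolding mixed_sum.simps distrib_left by (intro nsum_mono add_left_mono le)
      also have "\<dots> \<le> lam_total * (B + del_bound * lam_total ^ n * lam_total ^ Suc q)"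
        by (intro nsum_lam_le add_mono B mult_left_mono elem_sum_le) auto
      finally show ?thesis .
    qed
    moreover have "lam_total * (B + del_bound * lam_total ^ n * lam_total ^ Suc q) < top"
      using lam_total_finite del_bound B(1) by (auto simp: ennreal_mult_less_top power_less_top_ennreal)
    ultimately show ?case by blast
  qed
qed

theorem ribbon_eq: "ribbon (Suc n) q = mixed_sum (Suc n) q 0"
proof (induction n arbitrary: q)
  case 0
  show ?case using ribbon_1 by simp
next
  case (Suc n)
  have "mixed_sum (Suc n) (Suc q) 0 + ribbon (Suc (Suc n)) q = mixed_sum (Suc n) (Suc q) 0 + mixed_sum (Suc (Suc n)) q 0"
    using ribbon_rec[of "Suc n" q] mixed_sum_rec[of "Suc n" q 0] unfolding Suc
    by (simp only: mult.commute)
  \<comment> \<open>Cancelling a common summand in [0,\<infinity>] requires it to be finite.\<close>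
  moreover have "mixed_sum (Suc n) (Suc q) 0 < top"
    using mixed_sum_bounded[of n "Suc q"] by (meson order.strict_trans1)
  ultimately show ?case
    unfolding ennreal_add_left_cancel by auto
qed

lemma ribbon_finite: "ribbon (Suc n) q < top"
  unfolding ribbon_eq using mixed_sum_bounded[of n q] by (meson order.strict_trans1)

end

section \<open>The generating function of the weight sums\<close>

text \<open>The distributive law: for fixed \<open>as\<close> the entries of \<open>ks\<close> vary
  independently.\<close>

lemma nsum_list_all2:
  "(\<Sum>\<^sup>+ks. of_bool (list_all2 P as ks) * prod_list (map2 F as ks)) =
   prod_list (map (\<lambda>a. \<Sum>\<^sup>+k. of_bool (P a k) * F a k) as)"
proof (induction as)
  case Nil
  have "(\<Sum>\<^sup>+ks. of_bool (list_all2 P [] ks) * prod_list (map2 F [] ks)) =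
    (\<Sum>\<^sup>+ks. of_bool (ks = []) * prod_list (map2 F [] ks))"
    by (intro nsum_cong) auto
  then show ?case by (simp only: nsum_delta) simp
next
  case (Cons a as)
  have "(\<Sum>\<^sup>+ks. of_bool (list_all2 P (a # as) ks) * prod_list (map2 F (a # as) ks)) =
    (\<Sum>\<^sup>+k. \<Sum>\<^sup>+ks. (of_bool (P a k) * F a k) * (of_bool (list_all2 P as ks) * prod_list (map2 F as ks)))"
    by (subst nsum_list) (simp add: mult_ac of_bool_conj)
  then show ?case
    by (simp only: nsum_cmult nsum_multc Cons) simp
qed

lemma prod_list_map2_nth:
  "length xs = length ys \<Longrightarrow> prod_list (map2 f xs ys) = (\<Prod>i<length ys. f (xs ! i) (ys ! i))"
  by (simp add: prod.list_conv_set_nth atLeast0LessThan)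

lemma ennreal_infsum:
  assumes nn: "\<And>x. 0 \<le> f x" and fin: "(\<Sum>\<^sup>+x. of_bool (x \<in> A) * ennreal (f x)) < top"
  shows "ennreal (infsum f A) = (\<Sum>\<^sup>+x. of_bool (x \<in> A) * ennreal (f x))"
proof -
  have eq: "(\<Sum>\<^sup>+x. of_bool (x \<in> A) * ennreal (f x)) = (\<integral>\<^sup>+x. ennreal (f x) \<partial>count_space A)"
    unfolding nsum_def
    by (subst nn_integral_count_space_indicator, simp)
       (intro nn_integral_cong, auto split: split_indicator)
  have "integrable (count_space A) f"
    using fin nn unfolding eq by (intro integrableI_nonneg) auto
  then have "Infinite_Set_Sum.abs_summable_on f A" by (simp add: Infinite_Set_Sum.abs_summable_on_def)
  then show ?thesis
    unfolding eq using nn by (simp add: nn_integral_conv_infsetsum infsetsum_infsum)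
qed

lemma finite_indices:
  "finite {ks :: nat list list. map length ks = rs \<and> sum_list (map sum_list ks) \<le> w}"
proof (rule finite_subset)
  show "{ks :: nat list list. map length ks = rs \<and> sum_list (map sum_list ks) \<le> w} \<subseteq>
    {ks. set ks \<subseteq> {k. set k \<subseteq> {..w} \<and> length k \<le> sum_list rs} \<and> length ks = length rs}"
  proof safe
    fix ks k x
    assume *: "rs = map length ks" "sum_list (map sum_list ks) \<le> w" "k \<in> set ks"
    show "length k \<le> sum_list (map length ks)"
      using *(3) by (intro member_le_sum_list) auto
    assume "x \<in> set k"
    then have "x \<le> sum_list k" by (intro member_le_sum_list) auto
    also have "\<dots> \<le> sum_list (map sum_list ks)"
      using *(3) by (intro member_le_sum_list) auto
    finally show "x \<le> w" using *(2) by simp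
  qed auto
  show "finite {ks. set ks \<subseteq> {k. set k \<subseteq> {..w} \<and> length k \<le> sum_list rs} \<and> length ks = length rs}"
    by (intro finite_lists_length_eq finite_lists_length_le) simp
qed

section \<open>Factorisation of the summands and summation over all weights\<close>

definition monomial :: "nat list \<Rightarrow> nat list \<Rightarrow> real" where
  "monomial a k = prod_list (map2 (\<lambda>x k. 1 / real x ^ k) a k)"

definition summand :: "index list \<Rightarrow> index list \<Rightarrow> nat list list \<Rightarrow> nat list list \<Rightarrow> real" where
  "summand ls ks as bs = (\<Prod>i<length ks.
     1 / ((\<Prod>j<depth (ks ! i). real (as ! i ! j) ^ (ks ! i ! j)) *
          (\<Prod>j<depth (ls ! i). real (bs ! i ! j) ^ (ls ! i ! j))))"

lemma summand_nonneg: "0 \<le> summand ls ks as bs"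
  unfolding summand_def by (intro prod_nonneg divide_nonneg_nonneg mult_nonneg_nonneg prod_nonneg) auto

lemma summand_eq:
  assumes "map length as = map length ks" "map length bs = map length ls" "length ls = length ks"
  shows "summand ls ks as bs = prod_list (map2 monomial as ks) * prod_list (map2 monomial bs ls)"
proof -
  have len: "length as = length ks" "length bs = length ls"
    using assms(1,2) by (auto dest: map_eq_imp_length_eq)
  have "monomial (xs ! i) (ys ! i) = 1 / (\<Prod>j<length (ys ! i). real (xs ! i ! j) ^ (ys ! i ! j))"
    if "map length xs = map length ys" "i < length ys" for xs ys :: "nat list list" and i
  proof -
    have "length (xs ! i) = length (ys ! i)"
      using that by (metis length_map nth_map)
    then show ?thesis
      by (simp add: monomial_def prod_list_map2_nth prod_dividef)
  qed
  note m = this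
  have "summand ls ks as bs = (\<Prod>i<length ks. monomial (as ! i) (ks ! i) * monomial (bs ! i) (ls ! i))"
    unfolding summand_def using assms by (intro prod.cong) (simp_all add: m)
  then show ?thesis
    using assms(3) len by (simp only: prod.distrib prod_list_map2_nth)
qed

text \<open>The weight condition of \<open>S\<close> is split off, so that summing over all weights
  leaves a free sum over valid pairs.\<close>

definition valid :: "nat list \<Rightarrow> nat list \<Rightarrow> index list \<times> index list \<Rightarrow> bool" where
  "valid ss rs = (\<lambda>(ls, ks). map depth ls = ss \<and> map depth ks = rs \<and>
        (\<forall>l\<in>set ls. is_index l) \<and> (\<forall>k\<in>set ks. admissible k))"

definition weight :: "index list \<times> index list \<Rightarrow> nat" where
  "weight = (\<lambda>(ls, ks). sum_list (map wt ks) + sum_list (map wt ls))"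

lemma S_eq:
  "S w ss rs = (\<Sum>(ls, ks) | valid ss rs (ls, ks) \<and> weight (ls, ks) = w. multizeta ls ks)"
  unfolding S_def valid_def weight_def by (intro sum.cong) auto

lemma finite_valid: "finite {p. valid ss rs p \<and> weight p = w}"
proof (rule finite_subset)
  show "finite ({ls. map length ls = ss \<and> sum_list (map sum_list ls) \<le> w} \<times>
      {ks. map length ks = rs \<and> sum_list (map sum_list ks) \<le> w})"
    by (intro finite_cartesian_product finite_indices)
qed (auto simp: valid_def weight_def)

lemma multizeta_eq: "multizeta ls ks = (\<Sum>\<^sub>\<infinity>(as, bs)\<in>summation_range (map depth ls) (map depth ks). summand ls ks as bs)"
  by (simp add: multizeta_def summand_def)

lemma multizeta_nonneg: "0 \<le> multizeta ls ks"
  unfolding multizeta_eq by (intro infsum_nonneg) (auto simp: summand_nonneg)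

lemma S_nonneg: "0 \<le> S w ss rs"
  unfolding S_def by (intro sum_nonneg) (auto simp: multizeta_nonneg)

lemma map_length_ball_iff_list_all2:
  "map length ks = map length as \<and> (\<forall>k\<in>set ks. P k) \<longleftrightarrow> list_all2 (\<lambda>a k. length k = length a \<and> P k) as ks"
  unfolding list_all2_conv_all_nth all_set_conv_all_nth list_eq_iff_nth_eq by auto

lemma nsum_finite_set: "finite A \<Longrightarrow> (\<Sum>\<^sup>+x. of_bool (x \<in> A) * f x) = sum f A"
proof -
  assume A: "finite A"
  have "(\<Sum>\<^sup>+x. of_bool (x \<in> A) * f x) = (\<integral>\<^sup>+x. f x \<partial>count_space A)"
    unfolding nsum_def
    by (subst nn_integral_count_space_indicator, simp)
       (rule nn_integral_cong, simp split: split_indicator)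
  also have "\<dots> = sum f A"
    by (rule nn_integral_count_space_finite[OF A])
  finally show ?thesis .
qed

lemma prod_list_map2_nonneg:
  fixes f :: "'a \<Rightarrow> 'b \<Rightarrow> real"
  assumes "\<And>x y. 0 \<le> f x y"
  shows "0 \<le> prod_list (map2 f xs ys)"
  by (induction xs ys rule: list_induct2') (simp_all add: assms)

lemma ennreal_prod_list_map2:
  assumes "\<And>x y. 0 \<le> f x y"
  shows "ennreal (prod_list (map2 f xs ys)) = prod_list (map2 (\<lambda>x y. ennreal (f x y)) xs ys)"
  by (induction xs ys rule: list_induct2') (simp_all add: assms ennreal_mult prod_list_map2_nonneg)

lemma monomial_nonneg: "0 \<le> monomial a k"
  unfolding monomial_def by (rule prod_list_map2_nonneg) simp

lemma prod_list_power_mult: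
  fixes t :: real
  shows "length as = length ks \<Longrightarrow> prod_list (map2 (\<lambda>a k. t ^ sum_list k * F a k) as ks) =
    t ^ sum_list (map sum_list ks) * prod_list (map2 F as ks)"
  by (induction as ks rule: list_induct2) (simp_all add: power_add)

definition mono_gf :: "real \<Rightarrow> nat list \<Rightarrow> nat list \<Rightarrow> ennreal" where
  "mono_gf t a k = ennreal (t ^ sum_list k * monomial a k)"

text \<open>With the entries fixed, both the conditions on the exponents and the powers of
  \<open>t\<close> separate row by row.\<close>

lemma summand_gf:
  fixes t :: real
  assumes t: "0 < t" and len: "length ss = length rs"
    and rng: "(as, bs) \<in> summation_range ss rs"
  shows "of_bool (valid ss rs (ls, ks)) * (ennreal (t ^ weight (ls, ks)) * ennreal (summand ls ks as bs)) =
    (of_bool (list_all2 (\<lambda>b l. length l = length b \<and> is_index l) bs ls) * prod_list (map2 (mono_gf t) bs ls)) *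
    (of_bool (list_all2 (\<lambda>a k. length k = length a \<and> admissible k) as ks) * prod_list (map2 (mono_gf t) as ks))"
proof -
  have l: "map length as = rs" "map length bs = ss"
    using rng by (auto simp: summation_range_def)
  have v: "valid ss rs (ls, ks) \<longleftrightarrow>
     list_all2 (\<lambda>b l. length l = length b \<and> is_index l) bs ls \<and>
     list_all2 (\<lambda>a k. length k = length a \<and> admissible k) as ks"
    unfolding map_length_ball_iff_list_all2[symmetric] l by (auto simp: valid_def)
  show ?thesis
  proof (cases "valid ss rs (ls, ks)")
    case True
    then have l': "map length ks = rs" "map length ls = ss" by (simp_all add: valid_def)
    then have len': "length as = length ks" "length bs = length ls" "length ls = length ks"
      using l len by (metis length_map)+
    have "t ^ weight (ls, ks) * summand ls ks as bs =
      prod_list (map2 (\<lambda>a k. t ^ sum_list k * monomial a k) bs ls) *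
      prod_list (map2 (\<lambda>a k. t ^ sum_list k * monomial a k) as ks)"
      using l l' len' by (simp add: summand_eq prod_list_power_mult weight_def power_add)
    then have "ennreal (t ^ weight (ls, ks)) * ennreal (summand ls ks as bs) =
      ennreal (prod_list (map2 (\<lambda>a k. t ^ sum_list k * monomial a k) bs ls)) *
      ennreal (prod_list (map2 (\<lambda>a k. t ^ sum_list k * monomial a k) as ks))"
      using t by (simp add: summand_nonneg prod_list_map2_nonneg monomial_nonneg flip: ennreal_mult)
    then have "ennreal (t ^ weight (ls, ks)) * ennreal (summand ls ks as bs) =
      prod_list (map2 (mono_gf t) bs ls) * prod_list (map2 (mono_gf t) as ks)"
      using t by (simp only: ennreal_prod_list_map2 mono_gf_def[abs_def] mult_nonneg_nonneg monomial_nonneg zero_le_power less_imp_le)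
    then show ?thesis using True v by simp
  next
    case False
    then show ?thesis using v by auto
  qed
qed

text \<open>
  Unless the right-hand side is finite, the real-valued \<open>infsum\<close> in \<open>multizeta\<close> may be the
  junk value 0.
\<close>

lemma generating_function:
  fixes ss rs :: "nat list" and t :: real
  assumes t: "0 < t"
    and len: "length ss = length rs"
  defines "G \<equiv> \<Sum>\<^sup>+as. \<Sum>\<^sup>+bs. of_bool ((as, bs) \<in> summation_range ss rs) *
      (prod_list (map (\<lambda>a. \<Sum>\<^sup>+k. of_bool (length k = length a \<and> admissible k) * mono_gf t a k) as) *
       prod_list (map (\<lambda>b. \<Sum>\<^sup>+l. of_bool (length l = length b \<and> is_index l) * mono_gf t b l) bs))"
  assumes fin: "G < top"
  shows "(\<Sum>\<^sup>+w. ennreal (S w ss rs * t ^ w)) = G"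
proof -
  define M where "M = (\<lambda>(ls, ks). nsum (\<lambda>(as, bs). of_bool ((as, bs) \<in> summation_range ss rs) * ennreal (summand ls ks as bs)))"
  have pw: "ennreal (t ^ n) * x < top \<Longrightarrow> x < top" for n x
    using t by (auto simp: ennreal_mult_less_top)
  have tot: "(\<Sum>\<^sup>+p. of_bool (valid ss rs p) * (ennreal (t ^ weight p) * M p)) = G"
  proof -
    have "(\<Sum>\<^sup>+p. of_bool (valid ss rs p) * (ennreal (t ^ weight p) * M p)) =
      (\<Sum>\<^sup>+ls. \<Sum>\<^sup>+ks. \<Sum>\<^sup>+q. of_bool (valid ss rs (ls, ks)) * (ennreal (t ^ weight (ls, ks)) *
         (of_bool (q \<in> summation_range ss rs) * ennreal (summand ls ks (fst q) (snd q)))))"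
      by (subst nsum_prod) (simp only: M_def nsum_cmult case_prod_unfold fst_conv snd_conv prod.collapse)
    also have "\<dots> = (\<Sum>\<^sup>+q. \<Sum>\<^sup>+ls. \<Sum>\<^sup>+ks. of_bool (valid ss rs (ls, ks)) * (ennreal (t ^ weight (ls, ks)) *
         (of_bool (q \<in> summation_range ss rs) * ennreal (summand ls ks (fst q) (snd q)))))"
      by (subst (2) nsum_swap) (rule nsum_swap)
    also have "\<dots> = (\<Sum>\<^sup>+q. \<Sum>\<^sup>+ls. \<Sum>\<^sup>+ks. of_bool (q \<in> summation_range ss rs) *
       ((of_bool (list_all2 (\<lambda>b l. length l = length b \<and> is_index l) (snd q) ls) * prod_list (map2 (mono_gf t) (snd q) ls)) *
       (of_bool (list_all2 (\<lambda>a k. length k = length a \<and> admissible k) (fst q) ks) * prod_list (map2 (mono_gf t) (fst q) ks))))"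
    proof (intro nsum_cong)
      fix q ls ks
      show "of_bool (valid ss rs (ls, ks)) * (ennreal (t ^ weight (ls, ks)) *
         (of_bool (q \<in> summation_range ss rs) * ennreal (summand ls ks (fst q) (snd q)))) =
        of_bool (q \<in> summation_range ss rs) *
       ((of_bool (list_all2 (\<lambda>b l. length l = length b \<and> is_index l) (snd q) ls) * prod_list (map2 (mono_gf t) (snd q) ls)) *
       (of_bool (list_all2 (\<lambda>a k. length k = length a \<and> admissible k) (fst q) ks) * prod_list (map2 (mono_gf t) (fst q) ks)))"
        using summand_gf[OF t len, of "fst q" "snd q" ls ks] by (cases "q \<in> summation_range ss rs") simp_all
    qed
    also have "\<dots> = G"
      unfolding nsum_cmult nsum_multc nsum_list_all2 G_def
      by (subst nsum_prod) (simp only: fst_conv snd_conv mult.commute)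
    finally show ?thesis .
  qed
  have M: "ennreal (multizeta ls ks) = M (ls, ks)" if v: "valid ss rs (ls, ks)" for ls ks
  proof -
    \<comment> \<open>A single pair contributes at most the finite total, so its own sum is finite
      and the real \<open>infsum\<close> is genuine.\<close>
    have "ennreal (t ^ weight (ls, ks)) * M (ls, ks) \<le> G"
      using nsum_ge[of "\<lambda>p. of_bool (valid ss rs p) * (ennreal (t ^ weight p) * M p)" "(ls, ks)"] v
      by (simp only: tot of_bool_eq mult_1_left)
    from le_less_trans[OF this fin] have "M (ls, ks) < top"
      by (rule pw)
    moreover have M_eq: "M (ls, ks) = (\<Sum>\<^sup>+x. of_bool (x \<in> summation_range ss rs) *
        ennreal (case x of (as, bs) \<Rightarrow> summand ls ks as bs))"
      unfolding M_def case_prod_conv by (intro nsum_cong) (simp split: prod.split)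
    moreover have "map depth ls = ss" "map depth ks = rs"
      using v by (simp_all add: valid_def)
    ultimately show ?thesis
      unfolding multizeta_eq by (simp only:) (intro ennreal_infsum, auto simp: summand_nonneg)
  qed
  \<comment> \<open>Valid pairs are sorted by weight: each pair contributes to exactly one
    \<open>w\<close>.\<close>
  have "(\<Sum>\<^sup>+w. ennreal (S w ss rs * t ^ w)) =
    (\<Sum>\<^sup>+w. \<Sum>\<^sup>+p. of_bool (w = weight p) * (of_bool (valid ss rs p) * (ennreal (t ^ weight p) * M p)))"
  proof (intro nsum_cong)
    fix w
    have "ennreal (S w ss rs) = (\<Sum>p | valid ss rs p \<and> weight p = w. M p)"
      unfolding S_eq by (subst sum_ennreal[symmetric]) (auto simp: multizeta_nonneg M intro!: sum.cong)
    also have "\<dots> = (\<Sum>\<^sup>+p. of_bool (valid ss rs p \<and> weight p = w) * M p)"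
      using nsum_finite_set[OF finite_valid[of ss rs w], of M] by simp
    finally have "ennreal (S w ss rs) = (\<Sum>\<^sup>+p. of_bool (valid ss rs p \<and> weight p = w) * M p)" .
    then have "ennreal (S w ss rs * t ^ w) = (\<Sum>\<^sup>+p. of_bool (valid ss rs p \<and> weight p = w) * M p) * ennreal (t ^ w)"
      using t S_nonneg by (simp add: ennreal_mult)
    also have "\<dots> = (\<Sum>\<^sup>+p. of_bool (w = weight p) * (of_bool (valid ss rs p) * (ennreal (t ^ weight p) * M p)))"
      unfolding nsum_multc[symmetric] by (intro nsum_cong) (auto simp: mult_ac)
    finally show "ennreal (S w ss rs * t ^ w) =
      (\<Sum>\<^sup>+p. of_bool (w = weight p) * (of_bool (valid ss rs p) * (ennreal (t ^ weight p) * M p)))" .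
  qed
  also have "\<dots> = (\<Sum>\<^sup>+p. \<Sum>\<^sup>+w. of_bool (w = weight p) * (of_bool (valid ss rs p) * (ennreal (t ^ weight p) * M p)))"
    by (rule nsum_swap)
  also have "\<dots> = G"
    by (simp only: nsum_delta tot)
  finally show ?thesis .
qed

lemma nsum_geometric:
  assumes "0 < y" "y < 1"
  shows "(\<Sum>\<^sup>+k. of_bool (m < k) * ennreal (y ^ k)) = ennreal (y ^ Suc m / (1 - y))"
  unfolding nsum_nat_greater
proof (rule suminf_ennreal_eq)
  have "(\<lambda>k. y ^ Suc m * y ^ k) sums (y ^ Suc m * (1 / (1 - y)))"
    by (intro sums_mult geometric_sums) (use assms in simp)
  then show "(\<lambda>k. y ^ Suc (m + k)) sums (y ^ Suc m / (1 - y))"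
    by (simp add: power_add mult_ac)
qed (use assms in simp)

lemma nsum_singleton: "(\<Sum>\<^sup>+b. of_bool (length b = 1) * F b) = (\<Sum>\<^sup>+x. F [x])"
proof -
  have "(\<Sum>\<^sup>+xs. of_bool (length (x # xs) = 1) * F (x # xs)) = F [x]" for x
  proof -
    have "(\<Sum>\<^sup>+xs. of_bool (length (x # xs) = 1) * F (x # xs)) = (\<Sum>\<^sup>+xs. of_bool (xs = []) * F (x # xs))"
      by (intro nsum_cong) auto
    then show ?thesis by (simp only: nsum_delta)
  qed
  then show ?thesis by (subst nsum_list) simp
qed

lemma nsum_list2:
  assumes "\<And>bs. F [] bs = 0" "\<And>as. F as [] = 0"
  shows "(\<Sum>\<^sup>+as. \<Sum>\<^sup>+bs. F as bs) = (\<Sum>\<^sup>+a. \<Sum>\<^sup>+b. \<Sum>\<^sup>+as. \<Sum>\<^sup>+bs. F (a # as) (b # bs))"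
proof -
  have "(\<Sum>\<^sup>+as. \<Sum>\<^sup>+bs. F as bs) = (\<Sum>\<^sup>+a. \<Sum>\<^sup>+as. \<Sum>\<^sup>+b. \<Sum>\<^sup>+bs. F (a # as) (b # bs))"
  proof -
    have "F [] = (\<lambda>_. 0)" using assms(1) by auto
    then show ?thesis
      by (subst nsum_list) (simp add: assms(2) nsum_list[of "F (_ # _)"])
  qed
  also have "\<dots> = (\<Sum>\<^sup>+a. \<Sum>\<^sup>+b. \<Sum>\<^sup>+as. \<Sum>\<^sup>+bs. F (a # as) (b # bs))"
    by (rule nsum_cong) (rule nsum_swap)
  finally show ?thesis .
qed

section \<open>Row-by-row decomposition of the summation range\<close>

lemma Nil_notin_range:
  "([], bs) \<notin> summation_range ss (r # rs)" "(as, []) \<notin> summation_range (s # ss) rs"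
  by (auto simp: summation_range_def)

lemma range_Nil: "(as, bs) \<in> summation_range [] [] \<longleftrightarrow> as = [] \<and> bs = []"
  by (auto simp: summation_range_def)

lemma range_Cons:
  assumes "length ss = length rs"
  shows "(a # as, b # bs) \<in> summation_range (s # ss) (r # rs) \<longleftrightarrow>
    length a = r \<and> length b = s \<and> (\<forall>x\<in>set a. 0 < x) \<and> (\<forall>x\<in>set b. 0 < x) \<and>
    sorted_wrt (<) a \<and> sorted_wrt (\<le>) (ext_row b a) \<and>
    (rs \<noteq> [] \<longrightarrow> hd (ext_row (hd bs) (hd as)) < hd a) \<and> (as, bs) \<in> summation_range ss rs"
proof -
  have nat: "(\<forall>i. Suc i < length (r # rs) \<longrightarrow> P i) \<longleftrightarrow>
     (rs \<noteq> [] \<longrightarrow> P 0) \<and> (\<forall>i. Suc i < length rs \<longrightarrow> P (Suc i))" for P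
    by (cases rs) (auto simp: less_Suc_eq_0_disj)
  \<comment> \<open>The range is defined by positions, the recursion by heads; these agree because a
    further row exists.\<close>
  have hd: "hd as = as ! 0" "hd bs = bs ! 0" if "map length as = rs" "map length bs = ss" "rs \<noteq> []"
    using that assms by (cases as; cases bs; auto)+
  show ?thesis
  proof (cases "map length as = rs \<and> map length bs = ss \<and> rs \<noteq> []")
    case True
    with hd have "hd as = as ! 0" "hd bs = bs ! 0" by simp_all
    with True show ?thesis
      unfolding summation_range_def mem_Collect_eq case_prod_conv nat by (auto simp: All_less_Suc2)
  next
    case False
    then show ?thesis
      unfolding summation_range_def mem_Collect_eq case_prod_conv nat by (auto simp: All_less_Suc2)
  qed
qed

section \<open>Generating functions of a single row\<close>

context generating_variable
begin

lemma ratio_bounds: "0 < t / real x" "t / real x < 1" if "0 < x" for x :: nat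
  using that t_pos t_less by (auto simp: field_simps)

lemma nsum_powers:
  assumes "0 < x"
  shows "(\<Sum>\<^sup>+k. of_bool (0 < k) * ennreal (t ^ k * (1 / real x ^ k))) = g x"
    and "(\<Sum>\<^sup>+k. of_bool (2 \<le> k) * ennreal (t ^ k * (1 / real x ^ k))) = g x * h x"
proof -
  have e: "t ^ k * (1 / real x ^ k) = (t / real x) ^ k" for k
    by (simp add: power_divide)
  have q: "t / real x / (1 - t / real x) = t / (real x - t)"
    using assms by (simp add: field_simps)
  show "(\<Sum>\<^sup>+k. of_bool (0 < k) * ennreal (t ^ k * (1 / real x ^ k))) = g x"
    unfolding e nsum_geometric[OF ratio_bounds[OF assms]] by (simp only: power_Suc0_right q g_def)
  have "(\<Sum>\<^sup>+k. of_bool (1 < k) * ennreal ((t / real x) ^ k)) = ennreal (t / (real x - t) * (t / real x))"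
    unfolding nsum_geometric[OF ratio_bounds[OF assms]] q[symmetric] by (simp add: mult_ac)
  also have "\<dots> = g x * h x"
    unfolding h_def using assms t_pos by (intro g_mult[symmetric, of _ 0]) auto
  finally show "(\<Sum>\<^sup>+k. of_bool (2 \<le> k) * ennreal (t ^ k * (1 / real x ^ k))) = g x * h x"
    unfolding e by (simp add: numeral_2_eq_2 Suc_le_eq)
qed

lemma mono_gf_Cons:
  "mono_gf t (x # a) (l # k) = ennreal (t ^ l * (1 / real x ^ l)) * mono_gf t a k"
  using t_pos monomial_nonneg[of a k]
  by (simp add: mono_gf_def monomial_def power_add mult_ac flip: ennreal_mult)

lemma mono_gf_Nil [simp]: "mono_gf t [] [] = 1"
  by (simp add: mono_gf_def monomial_def)

lemma index_row_gf:
  "(\<forall>x\<in>set b. 0 < x) \<Longrightarrow>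
    (\<Sum>\<^sup>+l. of_bool (length l = length b \<and> is_index l) * mono_gf t b l) = prod_list (map g b)"
proof (induction b)
  case Nil
  have "(\<Sum>\<^sup>+l. of_bool (length l = length [] \<and> is_index l) * mono_gf t [] l) = (\<Sum>\<^sup>+l. of_bool (l = []) * mono_gf t [] l)"
    by (intro nsum_cong) (auto simp: is_index_def)
  then show ?case by (simp only: nsum_delta) simp
next
  case (Cons x b)
  have "(\<Sum>\<^sup>+l. of_bool (length l = length (x # b) \<and> is_index l) * mono_gf t (x # b) l) =
    (\<Sum>\<^sup>+k. \<Sum>\<^sup>+l. (of_bool (0 < k) * ennreal (t ^ k * (1 / real x ^ k))) *
      (of_bool (length l = length b \<and> is_index l) * mono_gf t b l))"
    by (subst nsum_list) (simp add: mono_gf_Cons is_index_def mult_ac of_bool_conj)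
  also have "\<dots> = g x * prod_list (map g b)"
    using Cons by (simp add: nsum_cmult nsum_multc nsum_powers(1)[simplified])
  finally show ?case by simp
qed

text \<open>Only the last exponent is restricted to be at least 2, so only the last entry
  contributes a factor \<open>h\<close>.\<close>

lemma admissible_row_gf:
  "a \<noteq> [] \<Longrightarrow> (\<forall>x\<in>set a. 0 < x) \<Longrightarrow>
    (\<Sum>\<^sup>+k. of_bool (length k = length a \<and> admissible k) * mono_gf t a k) = prod_list (map g a) * h (last a)"
proof (induction a rule: list_nonempty_induct)
  case (single x)
  have "(\<Sum>\<^sup>+k. of_bool (length k = length [x] \<and> admissible k) * mono_gf t [x] k) =
    (\<Sum>\<^sup>+k. of_bool (length k = 1) * (of_bool (2 \<le> last k) * mono_gf t [x] k))"
    by (intro nsum_cong) (auto simp: admissible_def is_index_def length_Suc_conv)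
  also have "\<dots> = (\<Sum>\<^sup>+k. of_bool (2 \<le> k) * ennreal (t ^ k * (1 / real x ^ k)))"
    unfolding nsum_singleton by (simp add: mono_gf_Cons)
  finally show ?case using single nsum_powers(2)[of x] by simp
next
  case (cons x a)
  have row: "of_bool (length (l # k) = length (x # a) \<and> admissible (l # k)) * mono_gf t (x # a) (l # k) =
      (of_bool (0 < l) * ennreal (t ^ l * (1 / real x ^ l))) *
      (of_bool (length k = length a \<and> admissible k) * mono_gf t a k)" for l k
    using cons(1) by (cases "k = []") (auto simp: mono_gf_Cons admissible_def is_index_def mult_ac)
  have "(\<Sum>\<^sup>+k. of_bool (length k = length (x # a) \<and> admissible k) * mono_gf t (x # a) k) =
    (\<Sum>\<^sup>+l. \<Sum>\<^sup>+k. (of_bool (0 < l) * ennreal (t ^ l * (1 / real x ^ l))) *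
      (of_bool (length k = length a \<and> admissible k) * mono_gf t a k))"
    by (subst nsum_list) (simp only: row, simp)
  also have "\<dots> = g x * (prod_list (map g a) * h (last a))"
    using cons by (simp add: nsum_cmult nsum_multc nsum_powers(1)[simplified])
  finally show ?case using cons(1) by (simp add: mult.assoc)
qed

end

section \<open>Identification of the generating function with a ribbon of chains\<close>

context weighted_chains
begin

text \<open>The test function \<open>f\<close> sees only the free entry of the first row. This lets
  the induction impose the link to a preceding row by choosing an indicator function for
  \<open>f\<close>.\<close>

lemma ribbon_range:
  assumes "1 \<le> r"
  shows "(\<Sum>\<^sup>+as. \<Sum>\<^sup>+bs. of_bool ((as, bs) \<in> summation_range (replicate n 1 @ [1]) (replicate n r @ [Suc r])) *
      (prod_list (map chain_weight as) * prod_list (map (\<lambda>b. prod_list (map g b)) bs) * f (hd (hd bs)))) =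
    (\<Sum>\<^sup>+b. of_bool (0 < b) * (f b * (g b * (join ^^ Suc n) (stack 0) b)))"
proof (induction n arbitrary: f)
  case 0
  have cond: "(a # as, b # bs) \<in> summation_range (replicate 0 1 @ [1]) (replicate 0 r @ [Suc r]) \<longleftrightarrow>
      as = [] \<and> bs = [] \<and> length b = 1 \<and> chain a \<and> 0 < hd b \<and> hd b \<le> last a" for a as b bs
    by (cases b) (auto simp: range_Cons range_Nil chain_def ext_row_def)
  have pt: "of_bool ((a # as, b # bs) \<in> summation_range (replicate 0 1 @ [1]) (replicate 0 r @ [Suc r])) *
      (prod_list (map chain_weight (a # as)) * prod_list (map (\<lambda>b. prod_list (map g b)) (b # bs)) * f (hd (hd (b # bs)))) =
    of_bool (as = []) * (of_bool (bs = []) * (of_bool (length b = 1) *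
      (of_bool (chain a \<and> 0 < hd b \<and> hd b \<le> last a) * (chain_weight a * prod_list (map g b) * f (hd b)))))" for a as b bs
    unfolding cond by auto
  have "(\<Sum>\<^sup>+as. \<Sum>\<^sup>+bs. of_bool ((as, bs) \<in> summation_range (replicate 0 1 @ [1]) (replicate 0 r @ [Suc r])) *
      (prod_list (map chain_weight as) * prod_list (map (\<lambda>b. prod_list (map g b)) bs) * f (hd (hd bs)))) =
    (\<Sum>\<^sup>+a. \<Sum>\<^sup>+b. \<Sum>\<^sup>+as::nat list list. \<Sum>\<^sup>+bs::nat list list. of_bool (as = []) * (of_bool (bs = []) * (of_bool (length b = 1) *
      (of_bool (chain a \<and> 0 < hd b \<and> hd b \<le> last a) * (chain_weight a * prod_list (map g b) * f (hd b))))))"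
  proof (subst nsum_list2)
    fix as bs :: "nat list list"
    show "of_bool (([], bs) \<in> summation_range (replicate 0 1 @ [1]) (replicate 0 r @ [Suc r])) *
      (prod_list (map chain_weight []) * prod_list (map (\<lambda>b. prod_list (map g b)) bs) * f (hd (hd bs))) = 0"
      by (simp add: Nil_notin_range)
    show "of_bool ((as, []) \<in> summation_range (replicate 0 1 @ [1]) (replicate 0 r @ [Suc r])) *
      (prod_list (map chain_weight as) * prod_list (map (\<lambda>b. prod_list (map g b)) []) * f (hd (hd []))) = 0"
      by (simp add: Nil_notin_range)
  qed (simp only: pt)
  also have "\<dots> = (\<Sum>\<^sup>+a. \<Sum>\<^sup>+b. of_bool (0 < b) * (f b * (g b *
      (of_bool (chain a \<and> b \<le> last a) * (chain_weight a * stack 0 (hd a))))))"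
    unfolding nsum_cmult nsum_delta nsum_singleton by (intro nsum_cong) (simp add: mult_ac of_bool_conj)
  also have "\<dots> = (\<Sum>\<^sup>+b. of_bool (0 < b) * (f b * (g b * (join ^^ Suc 0) (stack 0) b)))"
    by (subst nsum_swap) (simp add: nsum_cmult join_def)
  finally show ?case .
next
  case (Suc n)
  define ss rs where "ss = replicate n (1::nat) @ [1]" and "rs = replicate n r @ [Suc r]"
  have ssrs: "length ss = length rs" "replicate (Suc n) 1 @ [1] = 1 # ss" "replicate (Suc n) r @ [Suc r] = r # rs"
    "rs \<noteq> []"
    by (simp_all add: ss_def rs_def)
  \<comment> \<open>Each row of \<open>bs\<close> has exactly one entry, so the head of the extended
    row is a free variable rather than \<open>last a\<close>.\<close>
  have hd1: "hd (ext_row (hd bs) (hd as)) = hd (hd bs)" if "(as, bs) \<in> summation_range ss rs" for as bs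
  proof -
    have "map length bs = ss" using that by (simp add: summation_range_def)
    then have "length (hd bs) = 1" unfolding ss_def by (cases bs; cases n) auto
    then show ?thesis by (cases "hd bs") (auto simp: ext_row_def)
  qed
  have cond: "(a # as, b # bs) \<in> summation_range (1 # ss) (r # rs) \<longleftrightarrow>
      length b = 1 \<and> length a = r \<and> sorted_wrt (<) (0 # a) \<and> 0 < hd b \<and> hd b \<le> last a \<and>
      (as, bs) \<in> summation_range ss rs \<and> hd (hd bs) < hd a" for a as b bs
    using hd1[of as bs] ssrs(4)
    by (cases b) (auto simp: range_Cons[OF ssrs(1)] ext_row_def)
  let ?R = "(join ^^ Suc n) (stack 0)"
  have pt: "of_bool ((a # as, b # bs) \<in> summation_range (1 # ss) (r # rs)) *
      (prod_list (map chain_weight (a # as)) * prod_list (map (\<lambda>b. prod_list (map g b)) (b # bs)) * f (hd (hd (b # bs)))) =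
    of_bool (length b = 1) *
      ((of_bool (length a = r \<and> sorted_wrt (<) (0 # a) \<and> 0 < hd b \<and> hd b \<le> last a) *
        (chain_weight a * prod_list (map g b) * f (hd b))) *
      (of_bool ((as, bs) \<in> summation_range ss rs) *
       (prod_list (map chain_weight as) * prod_list (map (\<lambda>b. prod_list (map g b)) bs) * of_bool (hd (hd bs) < hd a))))" for a as b bs
    unfolding cond of_bool_conj by (simp add: mult_ac)
  have "(\<Sum>\<^sup>+as. \<Sum>\<^sup>+bs. of_bool ((as, bs) \<in> summation_range (1 # ss) (r # rs)) *
      (prod_list (map chain_weight as) * prod_list (map (\<lambda>b. prod_list (map g b)) bs) * f (hd (hd bs)))) =
    (\<Sum>\<^sup>+a. \<Sum>\<^sup>+b. \<Sum>\<^sup>+as. \<Sum>\<^sup>+bs. of_bool (length b = 1) *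
      ((of_bool (length a = r \<and> sorted_wrt (<) (0 # a) \<and> 0 < hd b \<and> hd b \<le> last a) *
        (chain_weight a * prod_list (map g b) * f (hd b))) *
      (of_bool ((as, bs) \<in> summation_range ss rs) *
       (prod_list (map chain_weight as) * prod_list (map (\<lambda>b. prod_list (map g b)) bs) * of_bool (hd (hd bs) < hd a)))))"
  proof (subst nsum_list2)
    fix as bs :: "nat list list"
    show "of_bool (([], bs) \<in> summation_range (1 # ss) (r # rs)) *
      (prod_list (map chain_weight []) * prod_list (map (\<lambda>b. prod_list (map g b)) bs) * f (hd (hd bs))) = 0"
      by (simp add: Nil_notin_range)
    show "of_bool ((as, []) \<in> summation_range (1 # ss) (r # rs)) *
      (prod_list (map chain_weight as) * prod_list (map (\<lambda>b. prod_list (map g b)) []) * f (hd (hd []))) = 0"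
      by (simp add: Nil_notin_range)
  qed (simp only: pt)
  \<comment> \<open>The induction hypothesis is applied with the indicator of
    \<open>x < hd a\<close> as test function.\<close>
  also have "\<dots> = (\<Sum>\<^sup>+a. \<Sum>\<^sup>+b. (of_bool (length a = r \<and> sorted_wrt (<) (0 # a) \<and> 0 < b \<and> b \<le> last a) *
        (chain_weight a * g b * f b)) * (\<Sum>\<^sup>+b'. of_bool (0 < b') * (of_bool (b' < hd a) * (g b' * ?R b'))))"
    unfolding nsum_cmult nsum_singleton ss_def rs_def Suc[of "\<lambda>x. of_bool (x < k)" for k] by simp
  also have "\<dots> = (\<Sum>\<^sup>+b. \<Sum>\<^sup>+b'. \<Sum>\<^sup>+a. (of_bool (0 < b) * (f b * g b)) *
      (of_bool (chain (b' # a) \<and> b \<le> last (b' # a)) * (chain_weight (b' # a) * ?R (hd (b' # a)))))"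
  proof -
    have "(\<Sum>\<^sup>+a. \<Sum>\<^sup>+b. (of_bool (length a = r \<and> sorted_wrt (<) (0 # a) \<and> 0 < b \<and> b \<le> last a) *
        (chain_weight a * g b * f b)) * (\<Sum>\<^sup>+b'. of_bool (0 < b') * (of_bool (b' < hd a) * (g b' * ?R b')))) =
      (\<Sum>\<^sup>+a. \<Sum>\<^sup>+b. \<Sum>\<^sup>+b'. (of_bool (0 < b) * (f b * g b)) *
      (of_bool (chain (b' # a) \<and> b \<le> last (b' # a)) * (chain_weight (b' # a) * ?R (hd (b' # a)))))"
      unfolding nsum_cmult[symmetric]
    proof (intro nsum_cong)
      fix a b b'
      \<comment> \<open>The free entry of the next row moves in front of \<open>a\<close> and
        completes a chain of length \<open>r + 1\<close>. Since \<open>r \<ge> 1\<close>, the row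
        \<open>a\<close> is non-empty and still supplies the maximum.\<close>
      have "length a = r \<and> sorted_wrt (<) (0 # a) \<and> b \<le> last a \<and> 0 < b' \<and> b' < hd a \<longleftrightarrow>
          chain (b' # a) \<and> b \<le> last (b' # a)"
        using assms by (cases a) (auto simp: chain_def)
      moreover have "chain_weight (b' # a) = g b' * chain_weight a" if "length a = r"
        using that assms by (auto simp: chain_weight_def mult.assoc)
      ultimately show "of_bool (length a = r \<and> sorted_wrt (<) (0 # a) \<and> 0 < b \<and> b \<le> last a) *
          (chain_weight a * g b * f b) * (of_bool (0 < b') * (of_bool (b' < hd a) * (g b' * ?R b'))) =
        (of_bool (0 < b) * (f b * g b)) *
        (of_bool (chain (b' # a) \<and> b \<le> last (b' # a)) * (chain_weight (b' # a) * ?R (hd (b' # a))))"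
        by (cases "chain (b' # a) \<and> b \<le> last (b' # a)") (auto simp: mult_ac simp del: funpow.simps)
    qed
    also have "\<dots> = (\<Sum>\<^sup>+b. \<Sum>\<^sup>+a. \<Sum>\<^sup>+b'. (of_bool (0 < b) * (f b * g b)) *
      (of_bool (chain (b' # a) \<and> b \<le> last (b' # a)) * (chain_weight (b' # a) * ?R (hd (b' # a)))))"
      by (rule nsum_swap)
    also have "\<dots> = (\<Sum>\<^sup>+b. \<Sum>\<^sup>+b'. \<Sum>\<^sup>+a. (of_bool (0 < b) * (f b * g b)) *
      (of_bool (chain (b' # a) \<and> b \<le> last (b' # a)) * (chain_weight (b' # a) * ?R (hd (b' # a)))))"
      by (rule nsum_cong) (rule nsum_swap)
    finally show ?thesis .
  qed
  also have "\<dots> = (\<Sum>\<^sup>+b. of_bool (0 < b) * (f b * (g b * (join ^^ Suc (Suc n)) (stack 0) b)))"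
  proof (rule nsum_cong)
    fix b
    have "(join ^^ Suc (Suc n)) (stack 0) b = (\<Sum>\<^sup>+xs. of_bool (chain xs \<and> b \<le> last xs) * (chain_weight xs * ?R (hd xs)))"
      by (simp add: join_def)
    also have "\<dots> = (\<Sum>\<^sup>+b'. \<Sum>\<^sup>+a. of_bool (chain (b' # a) \<and> b \<le> last (b' # a)) * (chain_weight (b' # a) * ?R (hd (b' # a))))"
      by (subst nsum_list) (simp add: chain_def del: funpow.simps)
    finally show "(\<Sum>\<^sup>+b'. \<Sum>\<^sup>+a. (of_bool (0 < b) * (f b * g b)) *
      (of_bool (chain (b' # a) \<and> b \<le> last (b' # a)) * (chain_weight (b' # a) * ?R (hd (b' # a))))) =
      of_bool (0 < b) * (f b * (g b * (join ^^ Suc (Suc n)) (stack 0) b))"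
      by (simp only: nsum_cmult mult.assoc)
  qed
  finally show ?case unfolding ssrs .
qed

lemma S_generating_function:
  assumes "1 \<le> r"
  shows "(\<Sum>\<^sup>+k. ennreal (S k (replicate n 1 @ [1]) (replicate n r @ [Suc r]) * t ^ k)) = ribbon (Suc n) 0"
proof -
  let ?ss = "replicate n (1::nat) @ [1]" and ?rs = "replicate n r @ [Suc r]"
  have eq: "(\<Sum>\<^sup>+as. \<Sum>\<^sup>+bs. of_bool ((as, bs) \<in> summation_range ?ss ?rs) *
      (prod_list (map (\<lambda>a. \<Sum>\<^sup>+k. of_bool (length k = length a \<and> admissible k) * mono_gf t a k) as) *
       prod_list (map (\<lambda>b. \<Sum>\<^sup>+l. of_bool (length l = length b \<and> is_index l) * mono_gf t b l) bs))) = ribbon (Suc n) 0"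
  proof -
    have "of_bool ((as, bs) \<in> summation_range ?ss ?rs) *
      (prod_list (map (\<lambda>a. \<Sum>\<^sup>+k. of_bool (length k = length a \<and> admissible k) * mono_gf t a k) as) *
       prod_list (map (\<lambda>b. \<Sum>\<^sup>+l. of_bool (length l = length b \<and> is_index l) * mono_gf t b l) bs)) =
      of_bool ((as, bs) \<in> summation_range ?ss ?rs) *
      (prod_list (map chain_weight as) * prod_list (map (\<lambda>b. prod_list (map g b)) bs) * 1)" for as bs
    proof (cases "(as, bs) \<in> summation_range ?ss ?rs")
      case True
      then have len: "map length as = ?rs" and pos: "\<And>a. a \<in> set as \<Longrightarrow> \<forall>x\<in>set a. 0 < x"
          "\<And>b. b \<in> set bs \<Longrightarrow> \<forall>x\<in>set b. 0 < x"
        by (auto simp: summation_range_def)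
      have ne: "a \<noteq> []" if "a \<in> set as" for a
      proof -
        have "length a \<in> set (map length as)" using that by simp
        then show ?thesis unfolding len using assms by auto
      qed
      have "map (\<lambda>a. \<Sum>\<^sup>+k. of_bool (length k = length a \<and> admissible k) * mono_gf t a k) as = map chain_weight as"
        using ne pos by (intro map_cong) (simp_all add: admissible_row_gf chain_weight_def)
      moreover have "map (\<lambda>b. \<Sum>\<^sup>+l. of_bool (length l = length b \<and> is_index l) * mono_gf t b l) bs =
          map (\<lambda>b. prod_list (map g b)) bs"
        using pos by (intro map_cong) (simp_all add: index_row_gf)
      ultimately show ?thesis by (simp only: mult_1_right)
    qed simp
    then show ?thesis
      using ribbon_range[OF assms, of n "\<lambda>_. 1"] by (simp only: ribbon_def mult_1_left)
  qed
  \<comment> \<open>The finiteness required of the generating function is that of the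
    ribbon.\<close>
  show ?thesis
    by (subst generating_function) (use t_pos eq ribbon_finite in simp_all)
qed

end

section \<open>Comparison of coefficients\<close>

text \<open>The binomial series with exponent \<open>- (n + 1)\<close> at
  \<open>- x\<close>.\<close>

lemma neg_binomial_sums:
  fixes x :: real
  assumes "\<bar>x\<bar> < 1"
  shows "(\<lambda>v. real ((n + v) choose n) * x ^ v) sums (1 / (1 - x) ^ Suc n)"
proof -
  have "(\<lambda>v. ((- real (Suc n)) gchoose v) * (- x) ^ v) sums ((1 + - x) powr (- real (Suc n)))"
    by (rule gen_binomial_real) (use assms in simp)
  moreover have "((- real (Suc n)) gchoose v) * (- x) ^ v = real ((n + v) choose n) * x ^ v" for v
  proof -
    have "((- real (Suc n)) gchoose v) = (-1) ^ v * (real (n + v) gchoose v)"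
      by (subst gbinomial_minus) (simp add: algebra_simps)
    also have "real (n + v) gchoose v = real ((n + v) choose n)"
      by (metis binomial_gbinomial binomial_symmetric add_diff_cancel_left' le_add1)
    finally have "((- real (Suc n)) gchoose v) = (-1) ^ v * real ((n + v) choose n)" .
    moreover have "(-1) ^ v * (- x) ^ v = x ^ v"
      unfolding power_mult_distrib[symmetric] by simp
    ultimately show ?thesis
      by (simp only: mult.commute[of "(-1) ^ v"] mult.assoc)
  qed
  moreover have "(1 + - x) powr (- real (Suc n)) = 1 / (1 - x) ^ Suc n"
    using assms by (simp only: powr_minus powr_realpow) (simp add: inverse_eq_divide)
  ultimately show ?thesis by simp
qed

text \<open>Here \<open>v\<close> counts the excess over the least weight. Then (w-1)/n = (r+1) +
  (n+v)/n, and absorption turns the second part into a binomial coefficient of order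
  \<open>n\<close>.\<close>

lemma c_eq:
  assumes "1 \<le> n"
  shows "c ((r + 2) * n + 1 + v) r n = real (Suc r) * real ((n - 1 + v) choose (n - 1)) + real ((n + v) choose n)"
proof -
  obtain k where n: "n = Suc k" using assms by (cases n) auto
  have "n * ((n + v) choose n) = (n + v) * ((n - 1 + v) choose (n - 1))"
    using binomial_absorption[of k "n + v"] by (simp add: n)
  then have "real n * real ((n + v) choose n) = real (n + v) * real ((n - 1 + v) choose (n - 1))"
    by (metis of_nat_mult)
  then have "real ((n + v) choose n) = real (n + v) / real n * real ((n - 1 + v) choose (n - 1))"
    using assms by (simp add: field_simps)
  moreover have "(r + 2) * n + 1 + v - (r + 1) * n - 2 = n - 1 + v"
    using assms by (simp add: algebra_simps)
  moreover have "real ((r + 2) * n + 1 + v - 1) / real n = real (Suc r) + real (n + v) / real n"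
    using assms by (simp add: field_simps)
  ultimately show ?thesis
    unfolding c_def by (simp only: distrib_right)
qed

lemma zeta_ennreal:
  assumes "2 \<le> s"
  shows "ennreal (zeta s) = (\<Sum>\<^sup>+m. of_bool (0 < m) * ennreal (1 / real m ^ s))"
  unfolding zeta_def nsum_nat_greater add_0
proof (rule suminf_ennreal2[symmetric])
  have "summable (\<lambda>m. inverse (real m ^ s))"
    by (rule inverse_power_summable[OF assms])
  from summable_Suc_iff[THEN iffD2, OF this] show "summable (\<lambda>m. 1 / real (Suc m) ^ s)"
    by (simp add: inverse_eq_divide)
qed simp

text \<open>The cutoff is the least weight that occurs; below it \<open>c\<close> may be non-zero,
  as for \<open>n = 1\<close>.\<close>

definition ribbon_coeff :: "nat \<Rightarrow> nat \<Rightarrow> nat \<Rightarrow> real" where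
  "ribbon_coeff r n w = of_bool ((r + 2) * n + 1 \<le> w) * (c w r n * zeta w)"

lemma zeta_nonneg: "0 \<le> zeta s" if "2 \<le> s"
  unfolding zeta_def
proof (rule suminf_nonneg)
  have "summable (\<lambda>m. inverse (real m ^ s))"
    by (rule inverse_power_summable[OF that])
  from summable_Suc_iff[THEN iffD2, OF this] show "summable (\<lambda>m. 1 / real (Suc m) ^ s)"
    by (simp add: inverse_eq_divide)
qed simp

context weighted_chains
begin

text \<open>In x = t/m the left side is x^N ((r+1)/(1-x)^n + 1/(1-x)^(n+1)); two negative binomial
  series give the two parts of \<open>c_eq\<close>.\<close>

lemma del_lam_sum:
  assumes m: "0 < m" and n: "1 \<le> n"
  defines "N \<equiv> (r + 2) * n + 1"
  shows "del m * lam m ^ n = (\<Sum>\<^sup>+v. ennreal (c (N + v) r n * t ^ (N + v)) * ennreal (1 / real m ^ (N + v)))"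
proof -
  define x where "x = t / real m"
  have x: "0 < x" "x < 1"
    using t_pos t_less m by (auto simp: x_def field_simps)
  have g: "g m = ennreal (x / (1 - x))" and h: "h m = ennreal x"
    using m by (simp_all add: g_def h_def x_def field_simps)
  have "(\<lambda>v. real (Suc r) * (real ((n - 1 + v) choose (n - 1)) * x ^ v) + real ((n + v) choose n) * x ^ v)
      sums (real (Suc r) * (1 / (1 - x) ^ n) + 1 / (1 - x) ^ Suc n)"
    using neg_binomial_sums[of x "n - 1"] neg_binomial_sums[of x n] x n
    by (intro sums_add sums_mult) simp_all
  then have "(\<lambda>v. x ^ N * (real (Suc r) * (real ((n - 1 + v) choose (n - 1)) * x ^ v) + real ((n + v) choose n) * x ^ v))
      sums (x ^ N * (real (Suc r) * (1 / (1 - x) ^ n) + 1 / (1 - x) ^ Suc n))"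
    by (rule sums_mult)
  also have "(\<lambda>v. x ^ N * (real (Suc r) * (real ((n - 1 + v) choose (n - 1)) * x ^ v) + real ((n + v) choose n) * x ^ v)) =
     (\<lambda>v. c (N + v) r n * x ^ (N + v))"
    unfolding N_def c_eq[OF n] by (simp add: fun_eq_iff power_add algebra_simps)
  also have "x ^ N * (real (Suc r) * (1 / (1 - x) ^ n) + 1 / (1 - x) ^ Suc n) =
     (real (Suc r) * x + x / (1 - x)) * (x ^ Suc r * (x / (1 - x))) ^ n"
  proof -
    have 1: "x ^ N = x * (x ^ Suc r * x) ^ n"
      by (simp add: N_def power_add power_mult power_mult_distrib)
    have 2: "(x ^ Suc r * (x / (1 - x))) ^ n = (x ^ Suc r * x) ^ n * (1 / (1 - x) ^ n)"
      by (simp add: power_mult_distrib power_divide)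
    have 3: "1 / (1 - x) ^ Suc n = 1 / (1 - x) * (1 / (1 - x) ^ n)"
      and 4: "x / (1 - x) = x * (1 / (1 - x))"
      by simp_all
    \<comment> \<open>\<open>A\<close> and \<open>B\<close> stand for \<open>1 / (1 - x) ^ n\<close>
      and \<open>1 / (1 - x)\<close>, which leaves an identity without denominators.\<close>
    have "x * P * (R * A + B * A) = (R * x + x * B) * (P * A)" for A B P R
      by (simp add: algebra_simps)
    then show ?thesis
      by (subst 1, subst 2, subst 3, subst 4)
  qed
  finally have sums: "(\<lambda>v. c (N + v) r n * x ^ (N + v)) sums
    ((real (Suc r) * x + x / (1 - x)) * (x ^ Suc r * (x / (1 - x))) ^ n)" .
  have c: "0 \<le> c k r n" for k by (simp add: c_def)
  have "del m * lam m ^ n = ennreal ((real (Suc r) * x + x / (1 - x)) * (x ^ Suc r * (x / (1 - x))) ^ n)"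
  proof -
    have "del m = ennreal (real (Suc r) * x + x / (1 - x))"
      using x by (simp add: del_def g h ennreal_of_nat_eq_real_of_nat ennreal_mult del: of_nat_Suc)
    moreover have "lam m = ennreal (x ^ Suc r * (x / (1 - x)))"
      using x unfolding lam_def g h by (simp only: ennreal_mult ennreal_power zero_le_power less_imp_le divide_nonneg_pos diff_gt_0_iff_gt)
    ultimately show ?thesis
      using x by (simp add: ennreal_mult ennreal_power del: power_Suc of_nat_Suc)
  qed
  also have "\<dots> = (\<Sum>\<^sup>+v. ennreal (c (N + v) r n * x ^ (N + v)))"
    unfolding nsum_nat by (rule suminf_ennreal_eq[symmetric, OF _ sums]) (use x c in simp)
  also have "\<dots> = (\<Sum>\<^sup>+v. ennreal (c (N + v) r n * t ^ (N + v)) * ennreal (1 / real m ^ (N + v)))"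
    using t_pos c by (intro nsum_cong) (simp add: x_def power_divide flip: ennreal_mult)
  finally show ?thesis .
qed

text \<open>Exchanging the sums over \<open>m\<close> and over the degree collects the powers of 1/m
  into zeta values, which converge because the least weight is at least 2.\<close>

lemma ribbon_power_series:
  assumes "1 \<le> n"
  shows "ribbon n 0 = (\<Sum>\<^sup>+w. ennreal (ribbon_coeff r n w * t ^ w))"
proof -
  define N where "N = (r + 2) * n + 1"
  have "1 \<le> (r + 2) * n" using assms by simp
  then have N: "2 \<le> N" unfolding N_def by linarith
  obtain k where k: "n = Suc k" using assms by (cases n) auto
  have c: "0 \<le> c k r n" for k by (simp add: c_def)
  have zero: "(\<Sum>w<N. ennreal (ribbon_coeff r n w * t ^ w)) = 0"
    unfolding ribbon_coeff_def N_def[symmetric] by (intro sum.neutral) simp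
  have "ribbon n 0 = (\<Sum>\<^sup>+m. of_bool (0 < m) * (del m * lam m ^ n))"
    unfolding k ribbon_eq by simp
  also have "\<dots> = (\<Sum>\<^sup>+m. of_bool (0 < m) * (\<Sum>\<^sup>+v. ennreal (c (N + v) r n * t ^ (N + v)) * ennreal (1 / real m ^ (N + v))))"
    by (intro nsum_cong) (use del_lam_sum assms N_def in auto)
  also have "\<dots> = (\<Sum>\<^sup>+v. \<Sum>\<^sup>+m. ennreal (c (N + v) r n * t ^ (N + v)) * (of_bool (0 < m) * ennreal (1 / real m ^ (N + v))))"
    unfolding nsum_cmult[symmetric] by (subst nsum_swap) (simp only: mult_ac)
  also have "\<dots> = (\<Sum>\<^sup>+v. ennreal (ribbon_coeff r n (N + v) * t ^ (N + v)))"
  proof (intro nsum_cong)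
    fix v
    have coeff: "ribbon_coeff r n (N + v) = c (N + v) r n * zeta (N + v)"
      unfolding ribbon_coeff_def N_def[symmetric] by simp
    have N': "2 \<le> N + v" using N by simp
    show "(\<Sum>\<^sup>+m. ennreal (c (N + v) r n * t ^ (N + v)) * (of_bool (0 < m) * ennreal (1 / real m ^ (N + v)))) =
        ennreal (ribbon_coeff r n (N + v) * t ^ (N + v))"
      using t_pos c zeta_nonneg[OF N'] unfolding nsum_cmult zeta_ennreal[OF N', symmetric]
      by (simp add: coeff mult_ac flip: ennreal_mult)
  qed
  also have "\<dots> = (\<Sum>w. ennreal (ribbon_coeff r n (w + N) * t ^ (w + N)))"
    unfolding nsum_nat by (simp only: add.commute[of N])
  also have "\<dots> = (\<Sum>w. ennreal (ribbon_coeff r n (w + N) * t ^ (w + N))) + (\<Sum>w<N. ennreal (ribbon_coeff r n w * t ^ w))"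
    using zero by simp
  also have "\<dots> = (\<Sum>\<^sup>+w. ennreal (ribbon_coeff r n w * t ^ w))"
    unfolding nsum_nat by (rule suminf_offset[symmetric]) simp
  finally show ?thesis .
qed

end

text \<open>Finiteness turns the equality into one of convergent real series. It is known only for
  positive \<open>t\<close>, so the coefficients are compared one after another through limits from
  the right at 0.\<close>

lemma powser_unique:
  fixes a b :: "nat \<Rightarrow> real"
  assumes nn: "\<And>n. 0 \<le> a n" "\<And>n. 0 \<le> b n"
    and eq: "\<And>t. 0 < t \<Longrightarrow> t < 1 \<Longrightarrow> (\<Sum>\<^sup>+n. ennreal (a n * t ^ n)) = (\<Sum>\<^sup>+n. ennreal (b n * t ^ n))"
    and fin: "\<And>t. 0 < t \<Longrightarrow> t < 1 \<Longrightarrow> (\<Sum>\<^sup>+n. ennreal (a n * t ^ n)) < top"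
  shows "a = b"
proof -
  have sums: "(\<lambda>n. (a n - b n) * t ^ n) sums 0" if t: "0 < t" "t < 1" for t
  proof -
    have "summable (\<lambda>n. a n * t ^ n)" "summable (\<lambda>n. b n * t ^ n)"
      using fin[OF t] eq[OF t] nn t unfolding nsum_nat
      by (auto intro!: summable_suminf_not_top)
    moreover from this have "(\<Sum>n. a n * t ^ n) = (\<Sum>n. b n * t ^ n)"
      using eq[OF t] nn t unfolding nsum_nat
      by (subst (asm) (1 2) suminf_ennreal2) (auto simp: suminf_nonneg)
    ultimately show ?thesis
      by (auto simp: sums_iff left_diff_distrib suminf_diff[symmetric] intro!: summable_diff)
  qed
  define d where "d = (\<lambda>n. a n - b n)"
  have "d n = 0" for n
  proof (induction n rule: less_induct)
    case (less n)
    show ?case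
    proof (rule ccontr)
      assume nz: "d n \<noteq> 0"
      \<comment> \<open>All lower coefficients vanish by induction, so the series may be divided by
        \<open>t ^ n\<close>.\<close>
      define e where "e k = d (k + n)" for k
      have e: "(\<lambda>k. e k * t ^ k) sums 0" if t: "0 < t" "t < 1" for t
      proof -
        have "(\<lambda>k. d (k + n) * t ^ (k + n)) sums 0"
          using sums[OF t] less by (subst sums_iff_shift) (simp flip: d_def, simp add: d_def)
        then have "(\<lambda>k. t ^ n * (e k * t ^ k)) sums (t ^ n * 0)"
          by (simp add: e_def power_add mult_ac)
        with t show ?thesis by (subst (asm) sums_mult_iff) auto
      qed
      \<comment> \<open>Convergence at the single point 1/2 gives convergence on a two-sided
        neighbourhood of 0.\<close>
      have summ: "summable (\<lambda>k. e k * x ^ k)" if "norm x < 1 / 2" for x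
        using powser_inside[OF sums_summable[OF e[of "1/2"]], of x] that by simp
      have "((\<lambda>x. \<Sum>k. e k * x ^ k) \<longlongrightarrow> e 0) (at 0)"
        by (rule powser_limit_0[where s = "1/2"]) (use summ in \<open>auto intro: summable_sums\<close>)
      then have "((\<lambda>x. \<Sum>k. e k * x ^ k) \<longlongrightarrow> e 0) (at_right 0)"
        by (rule tendsto_mono[OF at_le[OF subset_UNIV]])
      moreover have "eventually (\<lambda>x. (\<Sum>k. e k * x ^ k) = 0) (at_right 0)"
        by (rule eventually_at_rightI[of 0 1]) (simp_all add: sums_unique[OF e, symmetric])
      ultimately have "((\<lambda>x. 0) \<longlongrightarrow> e 0) (at_right (0::real))"
        by (rule Lim_transform_eventually)
      then have "e 0 = 0"
        by (simp add: tendsto_const_iff)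
      with nz show False by (simp add: e_def)
    qed
  qed
  then show ?thesis by (simp add: d_def fun_eq_iff)
qed

lemma ribbon_coeff_nonneg: "0 \<le> ribbon_coeff r n k" if "1 \<le> n"
proof (cases "(r + 2) * n + 1 \<le> k")
  case True
  moreover have "1 \<le> (r + 2) * n" using that by simp
  ultimately have "2 \<le> k" by linarith
  then show ?thesis by (simp add: ribbon_coeff_def c_def zeta_nonneg)
qed (simp add: ribbon_coeff_def)

theorem theorem3p9:
  fixes r n w :: nat
  assumes "1 \<le> r" and "1 \<le> n" and "(r + 2) * n + 1 \<le> w"
  shows "S w (replicate (n - 1) 1 @ [1]) (replicate (n - 1) r @ [r + 1]) = c w r n * zeta w"
proof -
  have n: "n = Suc (n - 1)" using assms(2) by simp
  \<comment> \<open>All weights are treated at once, including those below the least one, where the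
    coefficient on the right is 0.\<close>
  have "(\<lambda>k. S k (replicate (n - 1) 1 @ [1]) (replicate (n - 1) r @ [Suc r])) = ribbon_coeff r n"
  proof (rule powser_unique)
    fix t :: real
    assume "0 < t" "t < 1"
    then interpret weighted_chains t r by unfold_locales
    have gf: "(\<Sum>\<^sup>+k. ennreal (S k (replicate (n - 1) 1 @ [1]) (replicate (n - 1) r @ [Suc r]) * t ^ k)) = ribbon n 0"
      using S_generating_function[OF assms(1), of "n - 1"] n by simp
    show "(\<Sum>\<^sup>+k. ennreal (S k (replicate (n - 1) 1 @ [1]) (replicate (n - 1) r @ [Suc r]) * t ^ k)) =
        (\<Sum>\<^sup>+k. ennreal (ribbon_coeff r n k * t ^ k))"
      unfolding gf by (rule ribbon_power_series[OF assms(2)])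
    show "(\<Sum>\<^sup>+k. ennreal (S k (replicate (n - 1) 1 @ [1]) (replicate (n - 1) r @ [Suc r]) * t ^ k)) < top"
      unfolding gf by (subst n) (rule ribbon_finite)
  qed (simp_all add: S_nonneg ribbon_coeff_nonneg[OF assms(2)])
  from fun_cong[OF this, of w] show ?thesis
    using assms(3) by (simp add: ribbon_coeff_def)
qed

end
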